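(* There is an $\mathrm{O}(\log N)$-pass streaming algorithm with $\mathrm{O}(\log N)$ space, $3$ auxiliary read/write streams and $\mathrm{O}(1)$ processing time per letter which, given on its input stream the XML sequence $\mathrm{XML}(t)$ of any tree $t$ with $N$ nodes, computes $\mathrm{XML}(\mathrm{FCNS}(t))$ on the third auxiliary stream.
   Context: Trees: finite rooted ordered (unranked) trees whose nodes are labeled by letters of a finite alphabet $\Sigma$. For each label $a$ there is an opening tag $a$ and a closing tag $\bar a$. $\mathrm{XML}(t)$ is the sequence of tags obtained by a depth-first left-to-right traversal of $t$, writing the opening tag of a node when entering it and its closing tag when leaving it (length $2N$ for $N$ nodes); the input is assumed to be of this form and its length known in advance. The First-Child-Next-Sibling encoding $\mathrm{FCNS}(t)$ is the tree on the same node set, with the same root, in which each node has at most a left child and at most a right child: the left child of $v$ is the first child of $v$ in $t$ (if any) and the right child of $v$ is the next sibling of $v$ in $t$ (if any). Labels in $\mathrm{FCNS}(t)$ are annotated: a node is labeled $a_L$ if it is a left child (the root is annotated $L$ by convention) and $a_R$ if it is a right child, where $a$ is its label in $t$; $\mathrm{XML}(\mathrm{FCNS}(t))$ is its XML sequence with these annotated tags. Streaming model with external memory: besides internal memory (the space, counted in letters and bits), the algorithm has access to auxiliary read/write streams with sequential access; each cell holds a letter or a constant-size tuple of letters and integers in $[0,2N]$; at the start of each pass on an auxiliary stream the algorithm decides whether it reads or writes it; the number of passes counts all passes over input and auxiliary streams; processing time per letter is the maximal running time between two consecutive read/write operations, with arithmetic on integers in $[0,2N]$ in constant time. *)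

theory Defs
  imports
    Complex_Main
    "HOL-Library.Tree"
    "HOL-Library.Landau_Symbols"
    "HOL-Library.Log_Nat"
begin

section \<open>Trees, XML sequences and the First-Child-Next-Sibling encoding\<close>

datatype 'a tag = Open 'a | Close 'a

text \<open>Ordered unranked trees. The binary trees of the library (type \<open>tree\<close>, where
  \<open>Leaf\<close> means that the child is absent) serve as the target of the encoding.\<close>

datatype 'a utree = UNode 'a "'a utree list"

fun nodes :: "'a utree \<Rightarrow> nat" where
  "nodes (UNode a ts) = Suc (sum_list (map nodes ts))"

fun XML :: "'a utree \<Rightarrow> 'a tag list" where
  "XML (UNode a ts) = Open a # concat (map XML ts) @ [Close a]"

fun XML_bin :: "'a tree \<Rightarrow> 'a tag list" where
  "XML_bin Leaf = []"
| "XML_bin (Node l a r) = Open a # XML_bin l @ XML_bin r @ [Close a]"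

text \<open>A list of trees is read as the siblings from some node onwards: the left child of that
  node is the first of its children, and its right child is the next of the siblings.\<close>

fun fcns_siblings :: "'a utree list \<Rightarrow> 'a tree" where
  "fcns_siblings [] = Leaf"
| "fcns_siblings (UNode a ts # us) = Node (fcns_siblings ts) a (fcns_siblings us)"

datatype side = L | R

fun annotate :: "side \<Rightarrow> 'a tree \<Rightarrow> ('a \<times> side) tree" where
  "annotate d Leaf = Leaf"
| "annotate d (Node l a r) = Node (annotate L l) (a, d) (annotate R r)"

definition FCNS :: "'a utree \<Rightarrow> ('a \<times> side) tree" where
  "FCNS t = annotate L (fcns_siblings [t])"

text \<open>Tags over the plain alphabet, and tags over the annotated one.\<close>

type_synonym 'a letter = "'a tag + ('a \<times> side) tag"

instance tag :: (finite) finite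
proof
  have "x \<in> range Open \<union> range Close" for x :: "'a tag"
    by (cases x) auto
  then have UNIV_tag: "(UNIV :: 'a tag set) = range Open \<union> range Close"
    by auto
  show "finite (UNIV :: 'a tag set)"
    unfolding UNIV_tag by simp
qed

instance side :: finite
proof
  have "x \<in> {L, R}" for x
    by (cases x) auto
  then have UNIV_side: "(UNIV :: side set) = {L, R}"
    by auto
  show "finite (UNIV :: side set)"
    unfolding UNIV_side by simp
qed


section \<open>Streaming programs with external memory\<close>

datatype 'l val = Letter 'l | Num nat

datatype arith = Add | Sub | Mul | Div | Mod

text \<open>The internal memory is a random access memory, modelled as the list of the cells
  allocated so far. \<open>Cell b e\<close> is the content of the cell at address \<open>b + e\<close>, so \<open>Cell b (Const 0)\<close>
  is a register fixed in the program, whereas other offsets \<open>e\<close> give computed addresses.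
  Functions and predicates on letters are finite tables, because the letters of a program
  come from a finite type.\<close>

datatype 'l expr =
    Const nat
  | Symbol 'l
  | Cell nat "'l expr"
  | Arith arith "'l expr" "'l expr"
  | Map_Letter "'l \<Rightarrow> 'l" "'l expr"

datatype 'l test =
    Less "'l expr" "'l expr"
  | Equal "'l expr" "'l expr"
  | Holds "'l \<Rightarrow> bool" "'l expr"
  | At_End nat
  | Negate "'l test"
  | Conj "'l test" "'l test"

text \<open>Stream 0 is the input, streams 1, 2, ... are the auxiliary streams. \<open>Read i rs\<close> reads a cell,
  which holds a tuple, into the registers \<open>rs\<close>, and \<open>Write i es\<close> writes the tuple of the values of
  \<open>es\<close>; thus the size of a tuple is bounded by a constant of the program.\<close>

datatype 'l com =
    Skip
  | Assign nat "'l expr" "'l expr"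
  | Start_Read nat
  | Start_Write nat
  | Read nat "nat list"
  | Write nat "'l expr list"
  | Seq "'l com" "'l com"
  | Cond "'l test" "'l com" "'l com"
  | While "'l test" "'l com"

datatype head = Idle | Reading nat | Writing

text \<open>The last four fields measure resources: the passes started, the time since the last
  read/write operation, the maximal such time so far, and the peak size of the internal memory.\<close>

record 'l state =
  mem :: "'l val list"
  tape :: "nat \<Rightarrow> 'l val list list"
  head :: "nat \<Rightarrow> head"
  passes :: nat
  clock :: nat
  proc_time :: nat
  peak_space :: nat

text \<open>A letter has size 1; a number is counted by its binary digits (one digit for 0).\<close>

fun val_size :: "'l val \<Rightarrow> nat" where
  "val_size (Letter a) = 1"
| "val_size (Num n) = max 1 (floorlog 2 n)"

definition mem_size :: "'l val list \<Rightarrow> nat" where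
  "mem_size m = sum_list (map val_size m)"

text \<open>A cell that is skipped over is allocated (and paid for) as well; otherwise the choice
  of the addresses in use could store information at no cost.\<close>

definition store :: "nat \<Rightarrow> 'l val \<Rightarrow> 'l val list \<Rightarrow> 'l val list" where
  "store a v m = (if a < length m then m[a := v]
                  else m @ replicate (a - length m) (Num 0) @ [v])"

definition set_mem :: "'l val list \<Rightarrow> 'l state \<Rightarrow> 'l state" where
  "set_mem m s = s\<lparr>mem := m, peak_space := max (peak_space s) (mem_size m)\<rparr>"

definition tick :: "'l state \<Rightarrow> 'l state" where
  "tick s = s\<lparr>clock := Suc (clock s), proc_time := max (proc_time s) (Suc (clock s))\<rparr>"

definition tick_io :: "'l state \<Rightarrow> 'l state" where
  "tick_io s = (tick s)\<lparr>clock := 0\<rparr>"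

fun arith_op :: "arith \<Rightarrow> nat \<Rightarrow> nat \<Rightarrow> nat option" where
  "arith_op Add m n = Some (m + n)"
| "arith_op Sub m n = (if n \<le> m then Some (m - n) else None)"
| "arith_op Mul m n = Some (m * n)"
| "arith_op Div m n = (if n = 0 then None else Some (m div n))"
| "arith_op Mod m n = (if n = 0 then None else Some (m mod n))"

text \<open>Only integers in \<open>[0, M]\<close> are available: every other result is undefined, as is an access to
  a memory cell that was never allocated.\<close>

fun eval :: "nat \<Rightarrow> 'l val list \<Rightarrow> 'l expr \<Rightarrow> 'l val option" where
  "eval M m (Const n) = (if n \<le> M then Some (Num n) else None)"
| "eval M m (Symbol a) = Some (Letter a)"
| "eval M m (Cell b e) =
    (case eval M m e of
       Some (Num j) \<Rightarrow> if b + j < length m then Some (m ! (b + j)) else None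
     | _ \<Rightarrow> None)"
| "eval M m (Arith f e1 e2) =
    (case (eval M m e1, eval M m e2) of
       (Some (Num x), Some (Num y)) \<Rightarrow>
         (case arith_op f x y of
            Some z \<Rightarrow> if z \<le> M then Some (Num z) else None
          | None \<Rightarrow> None)
     | _ \<Rightarrow> None)"
| "eval M m (Map_Letter f e) =
    (case eval M m e of Some (Letter a) \<Rightarrow> Some (Letter (f a)) | _ \<Rightarrow> None)"

fun eval_test :: "nat \<Rightarrow> 'l state \<Rightarrow> 'l test \<Rightarrow> bool option" where
  "eval_test M s (Less e1 e2) =
    (case (eval M (mem s) e1, eval M (mem s) e2) of
       (Some (Num x), Some (Num y)) \<Rightarrow> Some (x < y)
     | _ \<Rightarrow> None)"
| "eval_test M s (Equal e1 e2) =
    (case (eval M (mem s) e1, eval M (mem s) e2) of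
       (Some v, Some w) \<Rightarrow> Some (v = w)
     | _ \<Rightarrow> None)"
| "eval_test M s (Holds P e) =
    (case eval M (mem s) e of Some (Letter a) \<Rightarrow> Some (P a) | _ \<Rightarrow> None)"
| "eval_test M s (At_End i) =
    (case head s i of Reading p \<Rightarrow> Some (length (tape s i) \<le> p) | _ \<Rightarrow> None)"
| "eval_test M s (Negate b) = map_option Not (eval_test M s b)"
| "eval_test M s (Conj b1 b2) =
    (case (eval_test M s b1, eval_test M s b2) of
       (Some x, Some y) \<Rightarrow> Some (x \<and> y)
     | _ \<Rightarrow> None)"

text \<open>\<open>exec k M c s s'\<close>: with \<open>k\<close> auxiliary streams and integers in \<open>[0, M]\<close>, program \<open>c\<close> started in
  \<open>s\<close> halts in \<open>s'\<close>. Each atomic command and each evaluation of a test takes one unit of time; this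
  is within a constant factor, since the expressions in a program have constant size. Illegal
  operations and divergence have no derivation. A write pass replaces the old
  content of the stream. Evaluating \<open>At_End\<close> is not a read/write operation.\<close>

inductive exec :: "nat \<Rightarrow> nat \<Rightarrow> 'l com \<Rightarrow> 'l state \<Rightarrow> 'l state \<Rightarrow> bool"
  for k M :: nat where
  Skip: "exec k M Skip s s"
| Assign: "\<lbrakk>eval M (mem s) i = Some (Num j); eval M (mem s) e = Some v\<rbrakk>
    \<Longrightarrow> exec k M (Assign b i e) s (tick (set_mem (store (b + j) v (mem s)) s))"
| Start_Read: "i \<le> k
    \<Longrightarrow> exec k M (Start_Read i) s
          (tick (s\<lparr>head := (head s)(i := Reading 0), passes := Suc (passes s)\<rparr>))"
| Start_Write: "\<lbrakk>1 \<le> i; i \<le> k\<rbrakk>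
    \<Longrightarrow> exec k M (Start_Write i) s
          (tick (s\<lparr>tape := (tape s)(i := []), head := (head s)(i := Writing),
                   passes := Suc (passes s)\<rparr>))"
| Read: "\<lbrakk>head s i = Reading p; p < length (tape s i); length rs = length (tape s i ! p)\<rbrakk>
    \<Longrightarrow> exec k M (Read i rs) s
          (tick_io (set_mem (fold (\<lambda>(r, v). store r v) (zip rs (tape s i ! p)) (mem s))
                            (s\<lparr>head := (head s)(i := Reading (Suc p))\<rparr>)))"
| Write: "\<lbrakk>head s i = Writing; es \<noteq> []; map (eval M (mem s)) es = map Some vs\<rbrakk>
    \<Longrightarrow> exec k M (Write i es) s (tick_io (s\<lparr>tape := (tape s)(i := tape s i @ [vs])\<rparr>))"
| Seq: "\<lbrakk>exec k M c1 s s'; exec k M c2 s' s''\<rbrakk> \<Longrightarrow> exec k M (Seq c1 c2) s s''"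
| Cond_True: "\<lbrakk>eval_test M s b = Some True; exec k M c1 (tick s) s'\<rbrakk>
    \<Longrightarrow> exec k M (Cond b c1 c2) s s'"
| Cond_False: "\<lbrakk>eval_test M s b = Some False; exec k M c2 (tick s) s'\<rbrakk>
    \<Longrightarrow> exec k M (Cond b c1 c2) s s'"
| While_False: "eval_test M s b = Some False \<Longrightarrow> exec k M (While b c) s (tick s)"
| While_True: "\<lbrakk>eval_test M s b = Some True; exec k M c (tick s) s'; exec k M (While b c) s' s''\<rbrakk>
    \<Longrightarrow> exec k M (While b c) s s''"

inductive_cases exec_cases:
  "exec k M Skip s s'" "exec k M (Assign b i e) s s'" "exec k M (Start_Read i) s s'"
  "exec k M (Start_Write i) s s'" "exec k M (Read i rs) s s'" "exec k M (Write i es) s s'"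
  "exec k M (Seq c1 c2) s s'" "exec k M (Cond b c1 c2) s s'"
inductive_cases exec_While: "exec k M (While b c) s s'"

lemma exec_deterministic:
  "exec k M c s s1 \<Longrightarrow> exec k M c s s2 \<Longrightarrow> s1 = s2"
proof (induction arbitrary: s2 rule: exec.induct)
  case (Skip s)
  then show ?case by (rule exec_cases) simp
next
  case (Assign s i j e v b)
  from Assign.prems show ?case by (rule exec_cases) (use Assign.hyps in simp)
next
  case (Start_Read i s)
  from Start_Read.prems show ?case by (rule exec_cases) simp
next
  case (Start_Write i s)
  from Start_Write.prems show ?case by (rule exec_cases) simp
next
  case (Read s i p rs)
  from Read.prems show ?case by (rule exec_cases) (use Read.hyps in simp)
next
  case (Write s i es vs)
  from Write.prems show ?case
    by (rule exec_cases) (use Write.hyps in \<open>simp add: inj_map_eq_map\<close>)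
next
  case (Seq c1 s s' c2 s'')
  from Seq.prems show ?case
  proof (rule exec_cases)
    fix u assume u: "exec k M c1 s u" "exec k M c2 u s2"
    with Seq.IH(1)[OF u(1)] show "s'' = s2" by (simp add: Seq.IH(2)[of s2])
  qed
next
  case (Cond_True s b c1 s' c2)
  from Cond_True.prems show ?case
    by (rule exec_cases) (simp_all add: Cond_True.hyps Cond_True.IH(1)[of s2])
next
  case (Cond_False s b c2 s' c1)
  from Cond_False.prems show ?case
    by (rule exec_cases) (simp_all add: Cond_False.hyps Cond_False.IH(1)[of s2])
next
  case (While_False s b c)
  from While_False.prems show ?case by (rule exec_While) (use While_False.hyps in simp_all)
next
  case (While_True s b c s' s'')
  from While_True.prems show ?case
  proof (rule exec_While)
    fix u assume u: "exec k M c (tick s) u" "exec k M (While b c) u s2"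
    with While_True.IH(1)[OF u(1)] show "s'' = s2" by (simp add: While_True.IH(2)[of s2])
  qed (use While_True.hyps in simp)
qed

definition on_stream :: "'l list \<Rightarrow> 'l val list list" where
  "on_stream w = map (\<lambda>a. [Letter a]) w"

text \<open>The length of the input is known in advance: it is in the first memory cell.\<close>

definition init :: "'l list \<Rightarrow> 'l state" where
  "init w = \<lparr>mem = [Num (length w)], tape = (\<lambda>i. if i = 0 then on_stream w else []),
             head = (\<lambda>i. Idle), passes = 0, clock = 0, proc_time = 0,
             peak_space = mem_size [Num (length w :: nat) :: 'l val]\<rparr>"

text \<open>With \<open>k\<close> auxiliary streams, at most \<open>p\<close> passes, at most \<open>sp\<close> space and processing time at
  most \<open>pt\<close> per letter, program \<open>c\<close> on input \<open>w\<close> halts with exactly \<open>w'\<close> on stream \<open>i\<close>.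
  The processing time also covers the time before the first and after the last
  read/write operation.\<close>

definition computes ::
  "nat \<Rightarrow> nat \<Rightarrow> nat \<Rightarrow> nat \<Rightarrow> ('l :: finite) com \<Rightarrow> 'l list \<Rightarrow> nat \<Rightarrow> 'l list \<Rightarrow> bool" where
  "computes k p sp pt c w i w' \<longleftrightarrow>
    (\<exists>s. exec k (length w) c (init w) s \<and> tape s i = on_stream w' \<and>
         passes s \<le> p \<and> peak_space s \<le> sp \<and> proc_time s \<le> pt)"

lemma length_XML: "length (XML t) = 2 * nodes t"
proof (induction t)
  case (UNode a ts)
  then have "sum_list (map (length \<circ> XML) ts) = 2 * sum_list (map nodes ts)"
    by (induction ts) auto
  then show ?case by (simp add: length_concat)
qed

end

theory Submission
  imports Defs "HOL-Library.Multiset"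
begin

text \<open>A closing tag of \<open>FCNS t\<close> stands where the parent of its node is closed in \<open>t\<close>, and siblings
  are closed there in reverse order, while the opening tags keep their order. Sort the tags of
  \<open>XML t\<close> by depth, and by decreasing position within each depth: every closing tag is then followed
  by the opening tags of the children of its node, last child first, so one scan can attach the
  position of the parent's closing tag to each node. The scan emits every opening tag with its own
  position as key and the matching closing tag with the parent's closing position as key; a stable
  sort by key gives \<open>XML (FCNS t)\<close>. Stable sorting is binary radix sort: each of the logarithmically
  many bits costs a constant number of passes over three streams.\<close>

section \<open>Resource bounds from the program text\<close>

text \<open>Attaching to each node the position of its parent's closing tag during a traversal would
  take a stack as deep as the tree. On a list sorted by depth one register suffices: the most recent
  closing tag is the parent's. For the root, the input length \<open>M\<close> acts as the position
  of a virtual closing tag around it. Ties in the last sort occur only among the closing tags of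
  siblings. They come from one depth level, where decreasing positions already put the last sibling
  first, as required; this is why stability matters. Decreasing positions are stored as
  \<open>M - p\<close>, so all sorts are increasing and all numbers stay in [0, \<open>M\<close>].
  The correctness proof tracks neither space nor processing time. Both follow from the shape of the
  program: constantly many cells with letters or numbers up to \<open>M\<close>, and a read/write
  operation in every loop iteration.\<close>

fun stores_below :: "nat \<Rightarrow> 'l com \<Rightarrow> bool" where
  "stores_below K (Assign b i e) = (b < K \<and> i = Const 0)"
| "stores_below K (Read i rs) = (\<forall>r\<in>set rs. r < K)"
| "stores_below K (Seq c1 c2) = (stores_below K c1 \<and> stores_below K c2)"
| "stores_below K (Cond b c1 c2) = (stores_below K c1 \<and> stores_below K c2)"
| "stores_below K (While b c) = stores_below K c"
| "stores_below K _ = True"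

fun bounded_val :: "nat \<Rightarrow> 'l val \<Rightarrow> bool" where
  "bounded_val M (Letter a) = True"
| "bounded_val M (Num n) = (n \<le> M)"

text \<open>\<open>eval\<close> is undefined on constants and arithmetic results above
  \<open>M\<close>, so a larger number could only come from memory.\<close>

lemma bounded_val_eval:
  assumes "\<forall>v\<in>set m. bounded_val M v" "eval M m e = Some v"
  shows "bounded_val M v"
  using assms
  by (induction e arbitrary: v) (auto split: option.splits val.splits if_splits)

lemma val_size_le:
  assumes "bounded_val M v" "1 \<le> M"
  shows "val_size v \<le> floorlog 2 M"
proof -
  have "1 \<le> floorlog 2 M"
    using assms(2) by (simp add: floorlog_def)
  moreover have "floorlog 2 n \<le> floorlog 2 M" if "v = Num n" for n
    using assms(1) that by (simp add: floorlog_mono)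
  ultimately show ?thesis
    by (cases v) simp_all
qed

lemma mem_size_le:
  assumes "\<forall>v\<in>set m. bounded_val M v" "1 \<le> M" "length m \<le> K"
  shows "mem_size m \<le> K * floorlog 2 M"
proof -
  have "mem_size m \<le> length m * floorlog 2 M"
    using assms(1)
  proof (induction m)
    case Nil
    then show ?case by (simp add: mem_size_def)
  next
    case (Cons v m)
    then have "mem_size m \<le> length m * floorlog 2 M" "bounded_val M v"
      by simp_all
    with val_size_le[OF this(2) assms(2)] show ?case by (simp add: mem_size_def)
  qed
  also have "\<dots> \<le> K * floorlog 2 M"
    using assms(3) by simp
  finally show ?thesis .
qed

lemma bounded_store:
  assumes "\<forall>w\<in>set m. bounded_val M w" "bounded_val M v"
  shows "\<forall>w\<in>set (store a v m). bounded_val M w"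
  using assms set_update_subset_insert[of m a v] by (auto simp: store_def)

lemma length_store: "length (store a v m) = max (length m) (Suc a)"
  by (auto simp: store_def)

lemma fold_store:
  assumes "\<forall>w\<in>set m. bounded_val M w" "length m \<le> K"
    and "\<forall>(r, v)\<in>set rvs. r < K \<and> bounded_val M v"
  shows "(\<forall>w\<in>set (fold (\<lambda>(r, v). store r v) rvs m). bounded_val M w) \<and>
    length (fold (\<lambda>(r, v). store r v) rvs m) \<le> K"
  using assms
proof (induction rvs arbitrary: m)
  case (Cons rv rvs)
  obtain r v where rv: "rv = (r, v)" by fastforce
  with Cons.prems have v: "bounded_val M v" and K: "length (store r v m) \<le> K"
    by (simp_all add: length_store)
  from Cons.IH[OF bounded_store[OF Cons.prems(1) v] K] show ?case
    using Cons.prems(3) rv by simp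
qed simp

text \<open>The streams belong to the invariant because a read copies their contents into
  memory.\<close>

definition bounded_state :: "nat \<Rightarrow> nat \<Rightarrow> 'l state \<Rightarrow> bool" where
  "bounded_state M K s \<longleftrightarrow> (\<forall>v\<in>set (mem s). bounded_val M v) \<and> length (mem s) \<le> K \<and>
    (\<forall>i. \<forall>vs\<in>set (tape s i). \<forall>v\<in>set vs. bounded_val M v) \<and>
    peak_space s \<le> K * floorlog 2 M"

lemma bounded_state_tick [simp]:
  "bounded_state M K (tick s) = bounded_state M K s"
  "bounded_state M K (tick_io s) = bounded_state M K s"
  by (simp_all add: bounded_state_def tick_def tick_io_def)

lemma bounded_state_set_mem:
  assumes "bounded_state M K s" "1 \<le> M" "\<forall>v\<in>set m. bounded_val M v" "length m \<le> K"
  shows "bounded_state M K (set_mem m s)"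
  using assms mem_size_le[of m M K] by (simp add: bounded_state_def set_mem_def)

text \<open>Offsets \<open>Const 0\<close> fix every written address in the program text, so at most
  \<open>K\<close> cells of \<open>floorlog 2 M\<close> digits each are ever paid for.\<close>

lemma exec_bounded_state:
  assumes "exec k M c s s'" "stores_below K c" "1 \<le> M" "bounded_state M K s"
  shows "bounded_state M K s'"
  using assms
proof (induction rule: exec.induct)
  case (Assign s i j e v b)
  have mem: "\<forall>v\<in>set (mem s). bounded_val M v" "length (mem s) \<le> K"
    using Assign.prems(3) by (simp_all add: bounded_state_def)
  have "b + j < K"
    using Assign.prems(1) Assign.hyps(1) by (auto split: if_splits)
  then have "bounded_state M K (set_mem (store (b + j) v (mem s)) s)"
    using mem bounded_store[OF mem(1) bounded_val_eval[OF mem(1) Assign.hyps(2)]]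
    by (intro bounded_state_set_mem Assign.prems) (simp_all add: length_store)
  then show ?case by simp
next
  case (Read s i p rs)
  let ?v = "tape s i ! p"
  have mem: "\<forall>v\<in>set (mem s). bounded_val M v" "length (mem s) \<le> K"
    using Read.prems(3) by (simp_all add: bounded_state_def)
  have "\<forall>v\<in>set ?v. bounded_val M v"
    using Read.prems(3) Read.hyps(2) nth_mem unfolding bounded_state_def by blast
  then have "\<forall>(r, v)\<in>set (zip rs ?v). r < K \<and> bounded_val M v"
    using Read.prems(1) by (auto dest: set_zip_leftD set_zip_rightD)
  note fold_store[OF mem this]
  moreover have "bounded_state M K (s\<lparr>head := (head s)(i := Reading (Suc p))\<rparr>)"
    using Read.prems(3) by (simp add: bounded_state_def)
  ultimately show ?case
    unfolding bounded_state_tick using bounded_state_set_mem Read.prems(2) by blast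
next
  case (Write s i es vs)
  have mem: "\<forall>v\<in>set (mem s). bounded_val M v"
    using Write.prems(3) by (simp add: bounded_state_def)
  have "bounded_val M v" if "v \<in> set vs" for v
  proof -
    from that have "Some v \<in> set (map (eval M (mem s)) es)"
      unfolding Write.hyps(3) by simp
    then obtain e where "eval M (mem s) e = Some v"
      by (metis imageE image_set)
    then show ?thesis
      by (rule bounded_val_eval[OF mem])
  qed
  with Write.prems(3) show ?case
    unfolding bounded_state_tick by (simp add: bounded_state_def ball_Un)
next
  case (Start_Read i s)
  then show ?case
    unfolding bounded_state_tick by (simp add: bounded_state_def)
next
  case (Start_Write i s)
  then show ?case
    unfolding bounded_state_tick by (simp add: bounded_state_def)
qed simp_all

section \<open>Time between read/write operations\<close>

text \<open>The operation must happen on every run; a \<open>While\<close> may run zero times and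
  therefore guarantees nothing.\<close>

fun does_io :: "'l com \<Rightarrow> bool" where
  "does_io (Read i rs) = True"
| "does_io (Write i es) = True"
| "does_io (Seq c1 c2) = (does_io c1 \<or> does_io c2)"
| "does_io (Cond b c1 c2) = (does_io c1 \<and> does_io c2)"
| "does_io _ = False"

fun loops_do_io :: "'l com \<Rightarrow> bool" where
  "loops_do_io (Seq c1 c2) = (loops_do_io c1 \<and> loops_do_io c2)"
| "loops_do_io (Cond b c1 c2) = (loops_do_io c1 \<and> loops_do_io c2)"
| "loops_do_io (While b c) = (loops_do_io c \<and> does_io c)"
| "loops_do_io _ = True"

text \<open>A clock reading of \<open>x\<close> before \<open>c\<close> becomes at most \<open>max x (reset_time c) + run_time c\<close>.
  The maximum accounts for the repetitions of a loop: after the first iteration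
  the clock no longer depends on \<open>x\<close>.\<close>

fun reset_time :: "'l com \<Rightarrow> nat" and run_time :: "'l com \<Rightarrow> nat" where
  "reset_time (Seq c1 c2) = reset_time c1 + reset_time c2"
| "reset_time (Cond b c1 c2) = reset_time c1 + reset_time c2"
| "reset_time (While b c) = reset_time c + run_time c"
| "reset_time _ = 0"
| "run_time (Seq c1 c2) = run_time c1 + run_time c2"
| "run_time (Cond b c1 c2) = Suc (run_time c1 + run_time c2)"
| "run_time (While b c) = Suc (reset_time c + run_time c)"
| "run_time _ = 1"

text \<open>The third conjunct carries the loop case: the body resets the clock, so all later
  iterations start from a reading bounded by the program text alone.\<close>

lemma exec_time:
  assumes "exec k M c s s'" "loops_do_io c"
  shows "clock s' \<le> max (clock s) (reset_time c) + run_time c \<and>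
    proc_time s' \<le> max (proc_time s) (max (clock s) (reset_time c) + run_time c) \<and>
    (does_io c \<longrightarrow> clock s' \<le> reset_time c + run_time c)"
  using assms
proof (induction rule: exec.induct)
  case (Seq c1 s s' c2 s'')
  then have 1: "clock s' \<le> max (clock s) (reset_time c1) + run_time c1"
    "proc_time s' \<le> max (proc_time s) (max (clock s) (reset_time c1) + run_time c1)"
    "does_io c1 \<longrightarrow> clock s' \<le> reset_time c1 + run_time c1" by simp_all
  from Seq have 2: "clock s'' \<le> max (clock s') (reset_time c2) + run_time c2"
    "proc_time s'' \<le> max (proc_time s') (max (clock s') (reset_time c2) + run_time c2)"
    "does_io c2 \<longrightarrow> clock s'' \<le> reset_time c2 + run_time c2" by simp_all
  have "clock s'' \<le> max (clock s) (reset_time (Seq c1 c2)) + run_time (Seq c1 c2)"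
    using 1(1) 2(1) by simp
  moreover have "proc_time s'' \<le>
      max (proc_time s) (max (clock s) (reset_time (Seq c1 c2)) + run_time (Seq c1 c2))"
    using 1(1,2) 2(2) by simp
  moreover have "does_io (Seq c1 c2) \<longrightarrow>
      clock s'' \<le> reset_time (Seq c1 c2) + run_time (Seq c1 c2)"
    using 1(3) 2(1,3) by auto
  ultimately show ?case by blast
qed (simp_all add: tick_def tick_io_def set_mem_def, linarith+)

section \<open>Weakest preconditions\<close>

text \<open>As \<open>exec\<close> is deterministic, existence of a run means total correctness. The
  rules for loop-free commands other than \<open>Read\<close> are equivalences, so that the
  simplifier executes such code symbolically.\<close>

definition wp :: "nat \<Rightarrow> nat \<Rightarrow> 'l com \<Rightarrow> ('l state \<Rightarrow> bool) \<Rightarrow> 'l state \<Rightarrow> bool" where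
  "wp k M c Q s \<longleftrightarrow> (\<exists>s'. exec k M c s s' \<and> Q s')"

lemma wp_mono: "wp k M c P s \<Longrightarrow> (\<And>s. P s \<Longrightarrow> Q s) \<Longrightarrow> wp k M c Q s"
  by (auto simp: wp_def)

lemma wp_Skip [simp]: "wp k M Skip Q s = Q s"
  by (auto simp: wp_def intro: exec.Skip elim: exec_cases)

lemma wp_Seq [simp]: "wp k M (Seq c1 c2) Q s = wp k M c1 (wp k M c2 Q) s"
  unfolding wp_def by (blast intro: exec.Seq elim: exec_cases)

abbreviation reg :: "nat \<Rightarrow> 'l expr" where
  "reg r \<equiv> Cell r (Const 0)"

abbreviation assign :: "nat \<Rightarrow> 'l expr \<Rightarrow> 'l com" where
  "assign r e \<equiv> Assign r (Const 0) e"

lemma wp_assign [simp]: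
  "wp k M (assign r e) Q s \<longleftrightarrow>
    (\<exists>v. eval M (mem s) e = Some v \<and> Q (tick (set_mem (store r v (mem s)) s)))"
  unfolding wp_def
  by (auto elim!: exec_cases) (auto intro!: exI exec.Assign[where j = 0, simplified])

lemma wp_Start_Read [simp]:
  "wp k M (Start_Read i) Q s \<longleftrightarrow>
    i \<le> k \<and> Q (tick (s\<lparr>head := (head s)(i := Reading 0), passes := Suc (passes s)\<rparr>))"
  unfolding wp_def by (auto elim: exec_cases intro: exec.Start_Read)

lemma wp_Start_Write [simp]:
  "wp k M (Start_Write i) Q s \<longleftrightarrow> 1 \<le> i \<and> i \<le> k \<and>
    Q (tick (s\<lparr>tape := (tape s)(i := []), head := (head s)(i := Writing),
      passes := Suc (passes s)\<rparr>))"
  unfolding wp_def by (auto elim: exec_cases intro!: exI exec.Start_Write)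

lemma wp_Write [simp]:
  "wp k M (Write i es) Q s \<longleftrightarrow>
    head s i = Writing \<and> es \<noteq> [] \<and> (\<forall>e\<in>set es. eval M (mem s) e \<noteq> None) \<and>
    Q (tick_io (s\<lparr>tape := (tape s)(i := tape s i @ [map (\<lambda>e. the (eval M (mem s) e)) es])\<rparr>))"
    (is "?l \<longleftrightarrow> ?r")
proof
  assume ?l
  then obtain s' where s': "exec k M (Write i es) s s'" "Q s'"
    by (auto simp: wp_def)
  from s'(1) show ?r
  proof (rule exec_cases)
    fix vs assume *: "s' = tick_io (s\<lparr>tape := (tape s)(i := tape s i @ [vs])\<rparr>)"
      "head s i = Writing" "es \<noteq> []" "map (eval M (mem s)) es = map Some vs"
    have "map (\<lambda>e. the (eval M (mem s) e)) es = map the (map (eval M (mem s)) es)"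
      by simp
    also have "\<dots> = vs"
      unfolding * by (simp add: comp_def)
    finally have vs: "map (\<lambda>e. the (eval M (mem s) e)) es = vs" .
    have "eval M (mem s) e \<noteq> None" if "e \<in> set es" for e
    proof -
      from that have "eval M (mem s) e \<in> set (map (eval M (mem s)) es)"
        by simp
      then show ?thesis unfolding * by auto
    qed
    with * vs s'(2) show ?r by simp
  qed
next
  assume r: ?r
  then have "map (eval M (mem s)) es = map Some (map (\<lambda>e. the (eval M (mem s) e)) es)"
    by auto
  with r show ?l
    unfolding wp_def by (blast intro: exec.Write)
qed

lemma wp_Cond [simp]:
  "wp k M (Cond b c1 c2) Q s \<longleftrightarrow>
    (case eval_test M s b of None \<Rightarrow> False | Some t \<Rightarrow> wp k M (if t then c1 else c2) Q (tick s))"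
proof -
  have "wp k M (Cond b c1 c2) Q s \<longleftrightarrow>
      (\<exists>t. eval_test M s b = Some t \<and> wp k M (if t then c1 else c2) Q (tick s))"
    unfolding wp_def
    by (auto elim!: exec_cases intro: exec.Cond_True exec.Cond_False split: if_splits)
  then show ?thesis
    by (auto split: option.split)
qed

lemma wp_While_False:
  "eval_test M s b = Some False \<Longrightarrow> Q (tick s) \<Longrightarrow> wp k M (While b c) Q s"
  unfolding wp_def by (blast intro: exec.While_False)

lemma wp_While_True:
  "eval_test M s b = Some True \<Longrightarrow> wp k M c (wp k M (While b c) Q) (tick s) \<Longrightarrow>
    wp k M (While b c) Q s"
  unfolding wp_def by (blast intro: exec.While_True)

section \<open>Loops over a stream\<close>

text \<open>A head is described by the suffix still to be read, so that invariants speak of lists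
  instead of indices.\<close>

definition unread :: "head \<Rightarrow> 'x list \<Rightarrow> 'x list \<Rightarrow> bool" where
  "unread h xs ys \<longleftrightarrow> (\<exists>p. h = Reading p \<and> p \<le> length xs \<and> drop p xs = ys)"

lemma unread_start [simp]: "unread (Reading 0) xs ys \<longleftrightarrow> ys = xs"
  by (auto simp: unread_def)

lemma At_End_unread:
  "unread (head s i) (tape s i) ys \<Longrightarrow> eval_test M s (At_End i) = Some (ys = [])"
  by (auto simp: unread_def)

lemma wp_Read:
  assumes "unread (head s i) (tape s i) (v # vs)" "length rs = length v"
    and "\<And>h. unread h (tape s i) vs \<Longrightarrow>
      Q (tick_io (set_mem (fold (\<lambda>(r, v). store r v) (zip rs v) (mem s))
        (s\<lparr>head := (head s)(i := h)\<rparr>)))"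
  shows "wp k M (Read i rs) Q s"
proof -
  obtain p where p: "head s i = Reading p" "drop p (tape s i) = v # vs"
    using assms(1) by (auto simp: unread_def)
  then have "p < length (tape s i)"
    by (metis drop_all linorder_not_less list.distinct(1))
  moreover from this p have "tape s i ! p = v" "drop (Suc p) (tape s i) = vs"
    by (metis Cons_nth_drop_Suc list.inject)+
  ultimately have "exec k M (Read i rs) s
      (tick_io (set_mem (fold (\<lambda>(r, v). store r v) (zip rs v) (mem s))
        (s\<lparr>head := (head s)(i := Reading (Suc p))\<rparr>)))"
    "unread (Reading (Suc p)) (tape s i) vs"
    using exec.Read[of s i p rs k M] p assms(2) by (auto simp: unread_def)
  with assms(3) show ?thesis
    unfolding wp_def by blast
qed

abbreviation each :: "nat \<Rightarrow> 'l com \<Rightarrow> 'l com" where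
  "each i c \<equiv> While (Negate (At_End i)) c"

text \<open>The invariant is indexed by the unread elements, and induction on this list also gives
  termination. The function \<open>f\<close> encodes an element as a stream cell.\<close>

lemma wp_each:
  assumes "I xs s"
    and "\<And>xs s. I xs s \<Longrightarrow> unread (head s i) (tape s i) (map f xs)"
    and "\<And>x xs s. I (x # xs) s \<Longrightarrow> wp k M c (I xs) (tick s)"
    and "\<And>s. I [] s \<Longrightarrow> Q (tick s)"
  shows "wp k M (each i c) Q s"
  using assms(1)
proof (induction xs arbitrary: s)
  case Nil
  then show ?case
    using At_End_unread[OF assms(2)[OF Nil]] assms(4)
    by (auto intro!: wp_While_False)
next
  case (Cons x xs)
  show ?case
  proof (rule wp_While_True)
    show "eval_test M s (Negate (At_End i)) = Some True"
      using At_End_unread[OF assms(2)[OF Cons.prems]] by simp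
    show "wp k M c (wp k M (each i c) Q) (tick s)"
      using assms(3)[OF Cons.prems] Cons.IH by (rule wp_mono)
  qed
qed

lemma state_simps [simp]:
  "mem (tick s) = mem s" "tape (tick s) = tape s" "head (tick s) = head s"
  "passes (tick s) = passes s"
  "mem (tick_io s) = mem s" "tape (tick_io s) = tape s" "head (tick_io s) = head s"
  "passes (tick_io s) = passes s"
  "mem (set_mem m s) = m" "tape (set_mem m s) = tape s" "head (set_mem m s) = head s"
  "passes (set_mem m s) = passes s"
  by (simp_all add: tick_def tick_io_def set_mem_def)

section \<open>The encoding by sorting\<close>

text \<open>A stable sort is determined by its buckets of equal keys. Equal buckets also give equal
  multisets, since all copies of an element lie in the bucket of its key.\<close>

lemma sort_key_eqI:
  assumes "sorted (map f ys)" "\<And>k. filter (\<lambda>x. f x = k) xs = filter (\<lambda>x. f x = k) ys"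
  shows "sort_key f xs = ys"
proof (rule properties_for_sort_key)
  show "mset ys = mset xs"
  proof (rule multiset_eqI)
    fix x
    have "count (mset zs) x = count (mset (filter (\<lambda>y. f y = f x) zs)) x" for zs
      by (simp add: mset_filter)
    then show "count (mset ys) x = count (mset xs) x"
      using assms(2) by metis
  qed
  show "filter (\<lambda>x. f k = f x) ys = filter (\<lambda>x. f k = f x) xs" for k
    using assms(2)[of "f k"] by (simp add: eq_commute)
qed (fact assms(1))

lemma sort_key_cong:
  assumes "\<And>x. x \<in> set xs \<Longrightarrow> f x = g x"
  shows "sort_key f xs = sort_key g xs"
proof -
  have "insort_key f x ys = insort_key g x ys" if "\<forall>y\<in>insert x (set ys). f y = g y" for x ys
    using that by (induction ys) simp_all
  with assms show ?thesis
    by (induction xs) simp_all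
qed

lemma sort_key_map: "sort_key f (map h xs) = map h (sort_key (\<lambda>x. f (h x)) xs)"
proof -
  have "insort_key f (h x) (map h ys) = map h (insort_key (\<lambda>x. f (h x)) x ys)" for x ys
    by (induction ys) simp_all
  then show ?thesis
    by (induction xs) simp_all
qed

text \<open>This explicit form allows the scan after the depth sort to be analysed one level at a
  time.\<close>

lemma sort_key_eq_buckets:
  fixes f :: "'x \<Rightarrow> nat"
  assumes "\<forall>x\<in>set xs. f x < n"
  shows "sort_key f xs = concat (map (\<lambda>k. filter (\<lambda>x. f x = k) xs) [0..<n])" (is "_ = ?b n")
proof (rule sort_key_eqI)
  have *: "\<forall>x\<in>set (?b n). f x < n" for n
    by auto
  show "sorted (map f (?b n))"
  proof (induction n)
    case (Suc n)
    have "sorted (map f (filter (\<lambda>x. f x = n) xs))"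
      by (rule sorted_map_same)
    with Suc *[of n] show ?case
      by (auto simp: sorted_append)
  qed simp
  show "filter (\<lambda>x. f x = k) xs = filter (\<lambda>x. f x = k) (?b n)" for k
  proof -
    have "filter (\<lambda>x. f x = k) (?b n) = (if k < n then filter (\<lambda>x. f x = k) xs else [])" for n
      by (induction n) (auto simp: less_Suc_eq filter_empty_conv intro!: filter_cong)
    moreover have "filter (\<lambda>x. f x = k) xs = []" if "\<not> k < n"
      using assms that by (auto simp: filter_empty_conv)
    ultimately show ?thesis by auto
  qed
qed

section \<open>Tags with positions, depths and keys\<close>

type_synonym 'a entry = "('a \<times> side) tag \<times> nat \<times> nat"

text \<open>The second component decreases along the input, the third one is the depth before the
  tag. Thus the children of a node have the level of its closing tag.\<close>

fun entries :: "nat \<Rightarrow> nat \<Rightarrow> nat \<Rightarrow> side \<Rightarrow> 'a tag list \<Rightarrow> 'a entry list" where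
  "entries M p d s [] = []"
| "entries M p d s (Open a # w) = (Open (a, s), M - p, d) # entries M (Suc p) (Suc d) L w"
| "entries M p d s (Close a # w) = (Close (a, R), M - p, d) # entries M (Suc p) (d - 1) R w"

text \<open>\<open>P\<close> is the register of the scan, the position of the latest closing tag;
  \<open>M - u\<close> undoes the reversal of positions. The 0 is padding that keeps all entries
  triples.\<close>

fun keyed_tags :: "nat \<Rightarrow> nat \<Rightarrow> 'a entry list \<Rightarrow> 'a entry list" where
  "keyed_tags M P [] = []"
| "keyed_tags M P ((Open x, u, d) # rs) = (Open x, M - u, 0) # (Close x, P, 0) # keyed_tags M P rs"
| "keyed_tags M P ((Close x, u, d) # rs) = keyed_tags M (M - u) rs"

definition second :: "'x \<times> nat \<times> nat \<Rightarrow> nat" where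
  "second r = fst (snd r)"

definition third :: "'x \<times> nat \<times> nat \<Rightarrow> nat" where
  "third r = snd (snd r)"

lemma second_third_simps [simp]: "second (x, y, z) = y" "third (x, y, z) = z"
  by (simp_all add: second_def third_def)

abbreviation width :: "'a utree list \<Rightarrow> nat" where
  "width ts \<equiv> length (concat (map XML ts))"

text \<open>The entries of a forest at position \<open>p\<close> and depth \<open>d\<close>, paired with the position \<open>P\<close> of the
  closing tag of the parent.\<close>

fun forest_entries :: "nat \<Rightarrow> nat \<Rightarrow> nat \<Rightarrow> side \<Rightarrow> 'a utree list \<Rightarrow> ('a entry \<times> nat) list" where
  "forest_entries p d P s [] = []"
| "forest_entries p d P s (UNode a us # ts) =
    (let q = Suc p + width us in
      ((Open (a, s), p, d), P) # forest_entries (Suc p) (Suc d) q L us @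
      ((Close (a, R), q, Suc d), 0) # forest_entries (Suc q) d P R ts)"

text \<open>This is what the last sort must produce. A closing tag follows the output of
  \<open>ts\<close> because the later siblings are nested inside the node as its right
  descendants.\<close>

fun forest_output :: "nat \<Rightarrow> nat \<Rightarrow> side \<Rightarrow> 'a utree list \<Rightarrow> 'a entry list" where
  "forest_output p P s [] = []"
| "forest_output p P s (UNode a us # ts) =
    (let q = Suc p + width us in
      (Open (a, s), p, 0) # forest_output (Suc p) q L us @ forest_output (Suc q) P R ts @
      [(Close (a, s), P, 0)])"

text \<open>The scan step with the parent's position supplied by the pairing instead of a register.
  The partner 0 of a closing tag in \<open>forest_entries\<close> is thus a dummy.\<close>

fun emit :: "'a entry \<times> nat \<Rightarrow> 'a entry list" where
  "emit ((Open x, p, d), P) = [(Open x, p, 0), (Close x, P, 0)]"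
| "emit ((Close x, p, d), P) = []"

text \<open>Inductions over forests use true positions, the program stores reversed ones; this map
  translates and forgets the pairing.\<close>

definition mirror :: "nat \<Rightarrow> 'a entry \<times> nat \<Rightarrow> 'a entry" where
  "mirror M r = (case r of ((x, p, d), P) \<Rightarrow> (x, M - p, d))"

lemma mirror_simps [simp]:
  "mirror M ((x, p, d), P) = (x, M - p, d)"
  "third (mirror M r) = third (fst r)" "second (mirror M r) = M - second (fst r)"
  by (simp_all add: mirror_def split: prod.splits)

text \<open>A forest returns to its initial depth, and a nonempty one ends with a closing tag, which
  makes the next node a right child.\<close>

lemma entries_forest:
  "entries M p d s (concat (map XML ts) @ w) =
    map (mirror M) (forest_entries p d P s ts) @
    entries M (p + width ts) d (if ts = [] then s else R) w"
proof (induction p d P s ts arbitrary: w rule: forest_entries.induct)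
  case (2 p d P s a us ts)
  note IH = 2(1)[OF refl] 2(2)[OF refl]
  show ?case
    using IH by (simp add: Let_def ac_simps)
qed simp

lemma map_fst_forest_output:
  "map fst (forest_output p P s ts) = XML_bin (annotate s (fcns_siblings ts))"
  by (induction p P s ts rule: forest_output.induct) (simp_all add: Let_def)

text \<open>Subforests occupy disjoint intervals of keys, which separates the parts of
  \<open>forest_output\<close> in the comparisons below.\<close>

lemma forest_output_keys:
  "r \<in> set (forest_output p P s ts) \<Longrightarrow> p + width ts \<le> P \<Longrightarrow>
    p \<le> second r \<and> (second r < p + width ts \<or> second r = P)"
proof (induction p P s ts rule: forest_output.induct)
  case (2 p P s a us ts)
  note IH = 2(1)[OF refl] 2(2)[OF refl]
  show ?case
    using 2(3,4) IH by (auto simp: Let_def)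
qed simp

lemma sorted_forest_output:
  "p + width ts \<le> P \<Longrightarrow> sorted (map second (forest_output p P s ts))"
proof (induction p P s ts rule: forest_output.induct)
  case (2 p P s a us ts)
  note IH = 2(1)[OF refl] 2(2)[OF refl]
  let ?q = "Suc p + width us"
  have le: "Suc ?q + width ts \<le> P"
    using 2(3) by simp
  have us: "Suc p \<le> second r \<and> second r \<le> ?q" if "r \<in> set (forest_output (Suc p) ?q L us)" for r
    using forest_output_keys[OF that] by auto
  have ts: "Suc ?q \<le> second r \<and> second r \<le> P" if "r \<in> set (forest_output (Suc ?q) P R ts)" for r
    using forest_output_keys[OF that le] le by auto
  show ?case
    using IH le us ts unfolding forest_output.simps Let_def
    by (fastforce simp: sorted_append)
qed simp

text \<open>A bucket is a single opening tag or the closing tags of one list of siblings; reversal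
  puts the latter in the order in which nested right children close.\<close>

lemma filter_emit_rev_forest_entries:
  "p + width ts \<le> P \<Longrightarrow>
    filter (\<lambda>r. second r = k) (concat (map emit (rev (forest_entries p d P s ts)))) =
    filter (\<lambda>r. second r = k) (forest_output p P s ts)"
proof (induction p d P s ts rule: forest_entries.induct)
  case (2 p d P s a us ts)
  note IH = 2(1)[OF refl] 2(2)[OF refl]
  let ?q = "Suc p + width us"
  have le: "Suc ?q + width ts \<le> P"
    using 2(3) by simp
  have us: "filter (\<lambda>r. second r = k) (forest_output (Suc p) ?q L us) = []"
    if "k \<le> p \<or> ?q < k"
    using forest_output_keys[of _ "Suc p" ?q L us] that by (fastforce simp: filter_empty_conv)
  have ts: "filter (\<lambda>r. second r = k) (forest_output (Suc ?q) P R ts) = []"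
    if "k \<le> ?q"
    using forest_output_keys[of _ "Suc ?q" P R ts] that le by (fastforce simp: filter_empty_conv)
  have IH1: "filter (\<lambda>r. second r = k)
      (concat (map emit (rev (forest_entries (Suc p) (Suc d) ?q L us)))) =
    filter (\<lambda>r. second r = k) (forest_output (Suc p) ?q L us)"
    using IH(1) by simp
  have IH2: "filter (\<lambda>r. second r = k)
      (concat (map emit (rev (forest_entries (Suc ?q) d P R ts)))) =
    filter (\<lambda>r. second r = k) (forest_output (Suc ?q) P R ts)"
    using IH(2) le by simp
  \<comment> \<open>The key \<open>?q\<close> belongs to the children: it is the key of their
    closing tags.\<close>
  consider "k < p" | "k = p" | "p < k" "k \<le> ?q" | "?q < k"
    by linarith
  then show ?case
    unfolding forest_entries.simps forest_output.simps Let_def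
    using us ts IH1 IH2 le
    by cases (simp_all del: filter_concat)
qed simp

text \<open>Hence a stable sort by level keeps the order of the emitted tags that have equal keys.\<close>

lemma level_of_key:
  "p + width ts \<le> P \<Longrightarrow> \<exists>f. f P = d \<and>
    (\<forall>r\<in>set (forest_entries p d P s ts). \<forall>r'\<in>set (emit r). third (fst r) = f (second r'))"
proof (induction p d P s ts rule: forest_entries.induct)
  case (2 p d P s a us ts)
  let ?q = "Suc p + width us"
  have le: "Suc ?q + width ts \<le> P"
    using 2(3) by simp
  obtain f where f: "\<forall>r\<in>set (forest_entries (Suc p) (Suc d) ?q L us).
      \<forall>r'\<in>set (emit r). third (fst r) = f (second r')"
    using 2(1)[OF refl] by auto
  obtain g where g: "g P = d" "\<forall>r\<in>set (forest_entries (Suc ?q) d P R ts).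
      \<forall>r'\<in>set (emit r). third (fst r) = g (second r')"
    using 2(2)[OF refl] le by auto
  \<comment> \<open>Equality of buckets transfers the key intervals from the output to the emitted
    tags.\<close>
  have keys: "\<exists>r\<in>set (forest_output p P s ts). second r = second r'"
    if "p + width ts \<le> P" "r \<in> set (forest_entries p d P s ts)" "r' \<in> set (emit r)"
    for p d P s r r' and ts :: "'a utree list"
  proof -
    have "r' \<in> set (filter (\<lambda>x. second x = second r')
        (concat (map emit (rev (forest_entries p d P s ts)))))"
      using that(2,3) by auto
    then show ?thesis
      unfolding filter_emit_rev_forest_entries[OF that(1)] by auto
  qed
  have us: "Suc p \<le> second r' \<and> second r' \<le> ?q"
    if "r \<in> set (forest_entries (Suc p) (Suc d) ?q L us)" "r' \<in> set (emit r)" for r r'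
    using keys[OF _ that] forest_output_keys[of _ "Suc p" ?q L us] by fastforce
  have ts: "Suc ?q \<le> second r' \<and> second r' \<le> P"
    if "r \<in> set (forest_entries (Suc ?q) d P R ts)" "r' \<in> set (emit r)" for r r'
    using keys[OF le that] forest_output_keys[OF _ le, of _ R] le by fastforce
  \<comment> \<open>The two level functions are glued along their disjoint key intervals;
    \<open>P\<close> exceeds \<open>?q\<close> and falls to \<open>g\<close>.\<close>
  define h where "h k = (if k = p then d else if k \<le> ?q then f k else g k)" for k
  have "h P = d"
    using le g(1) by (simp add: h_def)
  moreover have "third (fst r) = h (second r')"
    if "r \<in> set (forest_entries p d P s (UNode a us # ts))" "r' \<in> set (emit r)" for r r'
  proof -
    have "r = ((Open (a, s), p, d), P) \<or> r \<in> set (forest_entries (Suc p) (Suc d) ?q L us) \<or>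
        r = ((Close (a, R), ?q, Suc d), 0) \<or> r \<in> set (forest_entries (Suc ?q) d P R ts)"
      using that(1) unfolding forest_entries.simps Let_def by auto
    then show ?thesis
    proof (elim disjE)
      assume "r = ((Open (a, s), p, d), P)"
      then show ?thesis
        using that(2) \<open>h P = d\<close> by (auto simp: h_def)
    next
      assume r: "r \<in> set (forest_entries (Suc p) (Suc d) ?q L us)"
      from us[OF this that(2)] f r that(2) show ?thesis
        by (auto simp: h_def)
    next
      assume r: "r \<in> set (forest_entries (Suc ?q) d P R ts)"
      from ts[OF this that(2)] g(2) r that(2) show ?thesis
        by (auto simp: h_def)
    qed (use that(2) in simp)
  qed
  ultimately show ?case by blast
qed auto

lemma forest_entries_positions:
  "r \<in> set (forest_entries p d P s ts) \<Longrightarrow> p \<le> second (fst r) \<and> second (fst r) < p + width ts"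
proof (induction p d P s ts rule: forest_entries.induct)
  case (2 p d P s a us ts)
  note IH = 2(1)[OF refl] 2(2)[OF refl]
  show ?case
    using 2(3) IH by (auto simp: Let_def)
qed simp

lemma sorted_forest_entries:
  "sorted_wrt (<) (map (\<lambda>r. second (fst r)) (forest_entries p d P s ts))"
proof (induction p d P s ts rule: forest_entries.induct)
  case (2 p d P s a us ts)
  note IH = 2(1)[OF refl] 2(2)[OF refl]
  let ?q = "Suc p + width us"
  have us: "Suc p \<le> second (fst r) \<and> second (fst r) < ?q"
    if "r \<in> set (forest_entries (Suc p) (Suc d) ?q L us)" for r
    using forest_entries_positions[OF that] by simp
  have ts: "Suc ?q \<le> second (fst r)" if "r \<in> set (forest_entries (Suc ?q) d P R ts)" for r
    using forest_entries_positions[OF that] by simp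
  show ?case
    using IH us ts unfolding forest_entries.simps Let_def
    by (fastforce simp: sorted_wrt_append)
qed simp

lemma forest_entries_levels:
  "r \<in> set (forest_entries p d P s ts) \<Longrightarrow> d \<le> third (fst r)"
  by (induction p d P s ts rule: forest_entries.induct) (fastforce simp: Let_def)+

section \<open>The scan over the levels\<close>

text \<open>The register after the scan, needed to split a scan at an append.\<close>

fun last_close :: "nat \<Rightarrow> nat \<Rightarrow> 'a entry list \<Rightarrow> nat" where
  "last_close M P [] = P"
| "last_close M P ((Open x, u, d) # rs) = last_close M P rs"
| "last_close M P ((Close x, u, d) # rs) = last_close M (M - u) rs"

lemma keyed_tags_append:
  "keyed_tags M P (xs @ ys) = keyed_tags M P xs @ keyed_tags M (last_close M P xs) ys"
  by (induction M P xs rule: keyed_tags.induct) simp_all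

lemma last_close_append:
  "last_close M P (xs @ ys) = last_close M (last_close M P xs) ys"
  by (induction M P xs rule: last_close.induct) simp_all

text \<open>In reverse order, each level starts with a closing tag, except for the level of the roots.\<close>

lemma keyed_tags_level:
  assumes "p + width ts \<le> M" "k = d \<longrightarrow> P' = P"
  shows "(keyed_tags M P' (map (mirror M)
        (rev (filter (\<lambda>r. third (fst r) = k) (forest_entries p d P s ts)))) =
      concat (map emit (rev (filter (\<lambda>r. third (fst r) = k) (forest_entries p d P s ts))))) \<and>
    (k = d \<longrightarrow> last_close M P' (map (mirror M)
        (rev (filter (\<lambda>r. third (fst r) = k) (forest_entries p d P s ts)))) = P)"
  using assms
proof (induction p d P s ts arbitrary: P' rule: forest_entries.induct)
  case (2 p d P s a us ts)
  note IH = 2(1)[OF refl] 2(2)[OF refl]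
  let ?q = "Suc p + width us"
  have le: "Suc p + width us \<le> M" "Suc ?q + width ts \<le> M"
    using 2(3) by simp_all
  have none: "filter (\<lambda>r. third (fst r) = d) (forest_entries (Suc p) (Suc d) ?q L us) = []"
    using forest_entries_levels[of _ "Suc p" "Suc d"] by (fastforce simp: filter_empty_conv)
  note IH1 = IH(1)[OF le(1)] and IH2 = IH(2)[OF le(2), of P', OF 2(4)]
  consider "k = d" | "k = Suc d" | "k \<noteq> d" "k \<noteq> Suc d"
    by blast
  then show ?case
  proof cases
    case 1
    then show ?thesis
      using IH2 none le unfolding forest_entries.simps Let_def
      by (simp add: keyed_tags_append last_close_append)
  next
    case 2
    then show ?thesis
      \<comment> \<open>Reversed, the node's closing tag precedes the entries of its children and
        sets the register to \<open>M - (M - ?q)\<close>, which is \<open>?q\<close> by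
        \<open>le\<close>.\<close>
      using IH2 IH1[of ?q] le unfolding forest_entries.simps Let_def
      by (simp add: keyed_tags_append last_close_append)
  next
    case 3
    then show ?thesis
      using IH2 IH1 unfolding forest_entries.simps Let_def
      by (simp add: keyed_tags_append last_close_append)
  qed
qed simp

lemma keyed_tags_levels:
  assumes "width ts \<le> M"
  shows "keyed_tags M P (map (mirror M) (concat (map (\<lambda>k.
      rev (filter (\<lambda>r. third (fst r) = k) (forest_entries 0 0 P s ts))) [0..<n]))) =
    concat (map emit (concat (map (\<lambda>k.
      rev (filter (\<lambda>r. third (fst r) = k) (forest_entries 0 0 P s ts))) [0..<n])))"
proof (induction n)
  case (Suc n)
  \<comment> \<open>Only the level of the roots depends on the initial register, and no entries
    precede that level.\<close>
  have "n = 0 \<longrightarrow> last_close M P (map (mirror M) (concat (map (\<lambda>k.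
      rev (filter (\<lambda>r. third (fst r) = k) (forest_entries 0 0 P s ts))) [0..<n]))) = P"
    by simp
  from Suc keyed_tags_level[OF _ this, where p = 0 and ts = ts and s = s] assms show ?case
    by (simp add: keyed_tags_append)
qed simp

theorem FCNS_by_sorting:
  assumes "M = length (XML t)"
  shows "map fst (sort_key second (keyed_tags M M
    (sort_key third (sort_key second (entries M 0 0 L (XML t)))))) = XML_bin (FCNS t)"
proof -
  let ?F = "forest_entries 0 0 M L [t]"
  have M: "0 + width [t] \<le> M"
    by (simp add: assms)
  have "entries M 0 0 L (XML t) = map (mirror M) ?F"
    using entries_forest[of M 0 0 L "[t]" "[]" M] by simp
  \<comment> \<open>Positions are strictly increasing, so sorting by their mirror images is plain
    reversal.\<close>
  moreover have "sort_key (\<lambda>r. M - second (fst r)) ?F = rev ?F"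
  proof -
    have "sorted (map (\<lambda>r. M - second (fst r)) (rev ?F))"
      using sorted_wrt_mono_rel[OF _ sorted_forest_entries[of 0 0 M L "[t]", unfolded sorted_wrt_map]]
      by (simp add: sorted_wrt_map sorted_wrt_rev diff_le_mono2 less_imp_le)
    moreover have "inj_on (\<lambda>r. M - second (fst r)) (set ?F)"
    proof -
      have "distinct (map (\<lambda>r. second (fst r)) ?F)"
        using sorted_forest_entries[of 0 0 M L "[t]"] strict_sorted_iff by blast
      then have "inj_on (\<lambda>r. second (fst r)) (set ?F)"
        by (simp add: distinct_map)
      moreover have "second (fst r) \<le> M" if "r \<in> set ?F" for r
        using forest_entries_positions[OF that] M by simp
      ultimately show ?thesis
        unfolding inj_on_def by (metis diff_diff_cancel)
    qed
    ultimately show ?thesis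
      by (intro sort_key_inj_key_eq) simp_all
  qed
  ultimately have *: "sort_key second (entries M 0 0 L (XML t)) = map (mirror M) (rev ?F)"
    by (simp add: sort_key_map)
  obtain n where n: "\<forall>r\<in>set (rev ?F). third (fst r) < n"
    using finite_nat_set_iff_bounded[of "(\<lambda>r. third (fst r)) ` set (rev ?F)"] by auto
  define S where "S = concat (map (\<lambda>k. rev (filter (\<lambda>r. third (fst r) = k) ?F)) [0..<n])"
  have S: "sort_key (\<lambda>r. third (fst r)) (rev ?F) = S"
    unfolding S_def using sort_key_eq_buckets[OF n] by (simp add: rev_filter)
  have "keyed_tags M M (map (mirror M) S) = concat (map emit S)"
    unfolding S_def using M by (intro keyed_tags_levels) simp
  with * S have **: "keyed_tags M M
      (sort_key third (sort_key second (entries M 0 0 L (XML t)))) = concat (map emit S)"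
    by (simp add: sort_key_map)
  have "sort_key second (concat (map emit S)) = forest_output 0 M L [t]"
  proof (rule sort_key_eqI)
    show "sorted (map second (forest_output 0 M L [t]))"
      by (rule sorted_forest_output[OF M])
    fix k
    obtain f where f: "\<forall>r\<in>set ?F. \<forall>r'\<in>set (emit r). third (fst r) = f (second r')"
      using level_of_key[OF M, of 0 L] by blast
    let ?g = "\<lambda>r. filter (\<lambda>x. second x = k) (emit r)"
    \<comment> \<open>Tags with key \<open>k\<close> stem from level \<open>f k\<close> alone, and
      within one level the stable depth sort keeps the reversed order.\<close>
    have only: "concat (map ?g xs) = concat (map ?g (filter (\<lambda>r. third (fst r) = f k) xs))"
      if "set xs \<subseteq> set ?F" for xs
      using that
    proof (induction xs)
      case (Cons r xs)
      moreover have "?g r = []" if "third (fst r) \<noteq> f k"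
        using f Cons.prems that by (auto simp: filter_empty_conv)
      ultimately show ?case by simp
    qed simp
    have SF: "set S \<subseteq> set ?F"
      by (auto simp: S_def)
    have "filter (\<lambda>r. third (fst r) = f k) S = filter (\<lambda>r. third (fst r) = f k) (rev ?F)"
      unfolding S[symmetric] by (rule sort_key_stable)
    then have "concat (map ?g S) = concat (map ?g (rev ?F))"
      using only[OF SF] only[of "rev ?F"] by simp
    then have "filter (\<lambda>x. second x = k) (concat (map emit S)) =
        filter (\<lambda>x. second x = k) (concat (map emit (rev ?F)))"
      by (simp add: filter_concat comp_def)
    also have "\<dots> = filter (\<lambda>x. second x = k) (forest_output 0 M L [t])"
      by (rule filter_emit_rev_forest_entries[OF M])
    finally show "filter (\<lambda>x. second x = k) (concat (map emit S)) =
        filter (\<lambda>x. second x = k) (forest_output 0 M L [t])" .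
  qed
  with ** show ?thesis
    by (simp add: map_fst_forest_output FCNS_def)
qed

section \<open>The program\<close>

abbreviation copy_entries :: "nat \<Rightarrow> nat \<Rightarrow> 'l com" where
  "copy_entries i j \<equiv> each i (Seq (Read i [1, 2, 3]) (Write j [reg 1, reg 2, reg 3]))"

text \<open>The discarded first write is a read/write operation on every path, as \<open>loops_do_io\<close> demands
  of a loop body.\<close>

definition bit_pass :: "nat \<Rightarrow> nat \<Rightarrow> nat \<Rightarrow> nat \<Rightarrow> 'l com" where
  "bit_pass a b c key =
    Seq (Start_Write b) (Seq (Write b [Const 0])
    (Seq (Start_Read a) (Seq (Start_Write b) (Seq (Start_Write c)
    (Seq (each a (Seq (Read a [1, 2, 3])
      (Cond (Equal (Arith Mod (Arith Div (reg key) (reg 4)) (Const 2)) (Const 0))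
        (Write b [reg 1, reg 2, reg 3]) (Write c [reg 1, reg 2, reg 3]))))
    (Seq (Start_Read b) (Seq (Start_Read c) (Seq (Start_Write a)
    (Seq (copy_entries b a) (copy_entries c a))))))))))"

text \<open>In round \<open>j\<close> registers 4 and 5 hold \<open>2 ^ j\<close> and
  \<open>M div 2 ^ j\<close>. The inner test prevents doubling beyond \<open>M\<close>, where
  arithmetic is undefined.\<close>

definition radix_sort :: "nat \<Rightarrow> nat \<Rightarrow> nat \<Rightarrow> nat \<Rightarrow> 'l com" where
  "radix_sort a b c key =
    Seq (assign 4 (Const 1)) (Seq (assign 5 (reg 0))
    (While (Less (Const 0) (reg 5)) (Seq (bit_pass a b c key)
      (Seq (assign 5 (Arith Div (reg 5) (Const 2)))
        (Cond (Less (Const 0) (reg 5)) (assign 4 (Arith Mul (reg 4) (Const 2))) Skip)))))"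

fun annotated :: "side \<Rightarrow> 'a letter \<Rightarrow> 'a letter" where
  "annotated d (Inl (Open a)) = Inr (Open (a, d))"
| "annotated d (Inl (Close a)) = Inr (Close (a, d))"
| "annotated d (Inr x) = Inr x"

fun opens :: "'a letter \<Rightarrow> bool" where
  "opens (Inl (Open a)) = True"
| "opens (Inr (Open a)) = True"
| "opens _ = False"

fun closing :: "'a letter \<Rightarrow> 'a letter" where
  "closing (Inr (Open x)) = Inr (Close x)"
| "closing x = x"

text \<open>Registers 6, 7, 8 hold the position, the depth and whether the preceding tag is closing.
  The first assignment allocates all registers, with value 0.\<close>

definition write_entries :: "'a letter com" where
  "write_entries =
    Seq (assign 8 (Const 0)) (Seq (Start_Read 0) (Seq (Start_Write 1)
    (each 0 (Seq (Read 0 [1])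
      (Seq (Cond (Holds opens (reg 1))
        (Seq (Cond (Equal (reg 8) (Const 0))
          (Write 1 [Map_Letter (annotated L) (reg 1), Arith Sub (reg 0) (reg 6), reg 7])
          (Write 1 [Map_Letter (annotated R) (reg 1), Arith Sub (reg 0) (reg 6), reg 7]))
          (Seq (assign 8 (Const 0)) (assign 7 (Arith Add (reg 7) (Const 1)))))
        (Seq (Write 1 [Map_Letter (annotated R) (reg 1), Arith Sub (reg 0) (reg 6), reg 7])
          (Seq (assign 8 (Const 1)) (assign 7 (Arith Sub (reg 7) (Const 1))))))
      (assign 6 (Arith Add (reg 6) (Const 1))))))))"

text \<open>Register 6 is the second argument of \<open>keyed_tags\<close>; register 7 is the
  recovered position.\<close>

definition write_keyed_tags :: "'a letter com" where
  "write_keyed_tags =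
    Seq (assign 6 (reg 0)) (Seq (Start_Read 1) (Seq (Start_Write 2)
    (each 1 (Seq (Read 1 [1, 2, 3]) (Seq (assign 7 (Arith Sub (reg 0) (reg 2)))
      (Cond (Holds opens (reg 1))
        (Seq (Write 2 [reg 1, reg 7, Const 0])
          (Write 2 [Map_Letter closing (reg 1), reg 6, Const 0]))
        (assign 6 (reg 7))))))))"

definition write_tags :: "'l com" where
  "write_tags =
    Seq (Start_Read 2) (Seq (Start_Write 3)
    (each 2 (Seq (Read 2 [1, 2, 3]) (Write 3 [reg 1]))))"

text \<open>The last sort works on stream 2, where the scan leaves its result; stream 3 is scratch
  space until the final copy.\<close>

definition fcns_program :: "'a letter com" where
  "fcns_program =
    Seq write_entries (Seq (radix_sort 1 2 3 2) (Seq (radix_sort 1 2 3 3)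
    (Seq write_keyed_tags (Seq (radix_sort 2 1 3 2) write_tags))))"

lemmas program_defs = bit_pass_def radix_sort_def write_entries_def write_keyed_tags_def
  write_tags_def fcns_program_def

lemma stores_below_fcns_program: "stores_below 9 fcns_program"
  by (simp add: program_defs)

lemma loops_do_io_fcns_program: "loops_do_io fcns_program"
  by (simp add: program_defs)

section \<open>Correctness of the program\<close>

lemma store_in_range: "a < length m \<Longrightarrow> store a v m = m[a := v]"
  by (simp add: store_def)

text \<open>Registers 1, 2 and 3 hold the entry just read and may change.\<close>

definition frame :: "'l val list \<Rightarrow> 'l val list \<Rightarrow> bool" where
  "frame m m' \<longleftrightarrow> length m = 9 \<and> length m' = 9 \<and>
    (\<forall>r<9. r = 0 \<or> 4 \<le> r \<longrightarrow> m' ! r = m ! r)"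

lemma frame_nth: "frame m m' \<Longrightarrow> r < 9 \<Longrightarrow> r = 0 \<or> 4 \<le> r \<Longrightarrow> m' ! r = m ! r"
  unfolding frame_def by blast

lemma frame_refl: "length m = 9 \<Longrightarrow> frame m m"
  by (simp add: frame_def)

lemma frame_trans: "frame m m' \<Longrightarrow> frame m' m'' \<Longrightarrow> frame m m''"
  by (simp add: frame_def)

lemma frame_read: "frame m m' \<Longrightarrow> frame m (m'[Suc 0 := u, 2 := v, 3 := w])"
  by (auto simp: frame_def)

fun entry :: "('x \<Rightarrow> 'l) \<Rightarrow> 'x \<times> nat \<times> nat \<Rightarrow> 'l val list" where
  "entry g (x, y, z) = [Letter (g x), Num y, Num z]"

lemma wp_copy_entries:
  assumes "length (mem s) = 9" "i \<noteq> j"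
    and "unread (head s i) (tape s i) (map (entry g) xs)" "head s j = Writing"
    and Q: "\<And>s'. frame (mem s) (mem s') \<Longrightarrow> passes s' = passes s \<Longrightarrow>
      \<forall>l. l \<noteq> i \<longrightarrow> head s' l = head s l \<Longrightarrow>
      tape s' = (tape s)(j := tape s j @ map (entry g) xs) \<Longrightarrow> Q s'"
  shows "wp k M (copy_entries i j) Q s"
\<comment> \<open>The written part followed by the unread part stays constant; the other loop
  invariants have the same form.\<close>
proof (rule wp_each[where f = "entry g" and xs = xs and I = "\<lambda>ys s'.
    frame (mem s) (mem s') \<and> passes s' = passes s \<and> (\<forall>l. l \<noteq> i \<longrightarrow> head s' l = head s l) \<and>
    (\<forall>l. l \<noteq> j \<longrightarrow> tape s' l = tape s l) \<and>
    unread (head s' i) (tape s' i) (map (entry g) ys) \<and>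
    tape s' j @ map (entry g) ys = tape s j @ map (entry g) xs"], goal_cases)
  case 1
  then show ?case
    using assms by (auto simp: frame_refl)
next
  case (2 ys s')
  then show ?case by simp
next
  case (3 y ys s')
  obtain x u d where y: "y = (x, u, d)" by (cases y)
  have len: "length (mem s') = 9"
    using 3 by (simp add: frame_def)
  show ?case
    unfolding wp_Seq
    using 3 assms(2,4) len
    by (intro wp_Read[where v = "entry g y" and vs = "map (entry g) ys"])
      (auto simp: y store_in_range frame_read)
next
  case (4 s')
  then have "tape s' = (tape s)(j := tape s j @ map (entry g) xs)"
    by auto
  with 4 show ?case
    by (intro Q) simp_all
qed

section \<open>Radix sort\<close>

text \<open>By \<open>mod\<close>, bit \<open>j\<close> dominates the lower bits, and each bucket of
  the refined key lies in one half of the split, where it inherits its order from the previous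
  round.\<close>

lemma radix_step:
  fixes f :: "'x \<Rightarrow> nat"
  defines "ys j \<equiv> sort_key (\<lambda>r. f r mod 2 ^ j)"
  shows "filter (\<lambda>r. f r div 2 ^ j mod 2 = 0) (ys j xs) @
    filter (\<lambda>r. f r div 2 ^ j mod 2 \<noteq> 0) (ys j xs) = ys (Suc j) xs"
proof -
  let ?P = "\<lambda>r. f r div 2 ^ j mod 2 = 0"
  have mod: "f r mod 2 ^ Suc j = 2 ^ j * (f r div 2 ^ j mod 2) + f r mod 2 ^ j" for r
    unfolding power_Suc2 by (rule mod_mult2_eq)
  have less: "f r mod 2 ^ j < 2 ^ j" for r
    by simp
  have refine: "filter C (filter P zs @ filter (\<lambda>r. \<not> P r) zs) = filter C zs"
    if "(\<forall>r. C r \<longrightarrow> P r) \<or> (\<forall>r. C r \<longrightarrow> \<not> P r)" for C P :: "'x \<Rightarrow> bool" and zs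
  proof -
    have "(\<lambda>r. P r \<and> C r) = C \<and> (\<lambda>r. \<not> P r \<and> C r) = (\<lambda>r. False) \<or>
        (\<lambda>r. P r \<and> C r) = (\<lambda>r. False) \<and> (\<lambda>r. \<not> P r \<and> C r) = C"
      using that by auto
    then show ?thesis
      by (elim disjE conjE) simp_all
  qed
  have srt: "sorted (map (\<lambda>r. f r mod 2 ^ j) (ys j xs))"
    by (simp add: ys_def)
  have 0: "sorted (map (\<lambda>r. f r mod 2 ^ Suc j) (filter ?P (ys j xs)))"
  proof -
    have *: "map (\<lambda>r. f r mod 2 ^ Suc j) (filter ?P (ys j xs)) =
        map (\<lambda>r. f r mod 2 ^ j) (filter ?P (ys j xs))"
      by (rule map_cong[OF refl]) (simp only: mod, simp)
    show ?thesis
      unfolding * by (rule sorted_filter[OF srt])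
  qed
  have 1: "sorted (map (\<lambda>r. f r mod 2 ^ Suc j) (filter (\<lambda>r. \<not> ?P r) (ys j xs)))"
  proof -
    have *: "map (\<lambda>r. f r mod 2 ^ Suc j) (filter (\<lambda>r. \<not> ?P r) (ys j xs)) =
        map (\<lambda>x. 2 ^ j + x) (map (\<lambda>r. f r mod 2 ^ j) (filter (\<lambda>r. \<not> ?P r) (ys j xs)))"
      unfolding map_map by (rule map_cong[OF refl]) (simp only: mod, simp)
    show ?thesis
      unfolding * using sorted_filter[OF srt] by (simp add: sorted_map sorted_wrt_map)
  qed
  have le: "f r mod 2 ^ Suc j \<le> f r' mod 2 ^ Suc j" if "?P r" "\<not> ?P r'" for r r'
    using that less[of r] unfolding mod by (simp add: trans_le_add1)
  have "sort_key (\<lambda>r. f r mod 2 ^ Suc j) xs =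
      filter ?P (ys j xs) @ filter (\<lambda>r. \<not> ?P r) (ys j xs)"
  proof (rule sort_key_eqI)
    show "sorted (map (\<lambda>r. f r mod 2 ^ Suc j)
        (filter ?P (ys j xs) @ filter (\<lambda>r. \<not> ?P r) (ys j xs)))"
      unfolding map_append sorted_append using 0 1 le by auto
    fix n
    let ?C = "\<lambda>r. f r mod 2 ^ Suc j = n"
    \<comment> \<open>Agreement on \<open>Suc j\<close> bits implies agreement on \<open>j\<close>
      bits, so stability of the previous sort applies.\<close>
    have C: "filter ?C zs = filter ?C (filter (\<lambda>r. f r mod 2 ^ j = n mod 2 ^ j) zs)" for zs
      unfolding filter_filter by (rule filter_cong[OF refl]) (auto simp: mod_mod_cancel)
    note C[of "ys j xs"]
    also have "filter (\<lambda>r. f r mod 2 ^ j = n mod 2 ^ j) (ys j xs) =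
        filter (\<lambda>r. f r mod 2 ^ j = n mod 2 ^ j) xs"
      unfolding ys_def by (rule sort_key_stable)
    also note C[of xs, symmetric]
    finally have "filter ?C (ys j xs) = filter ?C xs" .
    moreover have "(\<forall>r. ?C r \<longrightarrow> ?P r) \<or> (\<forall>r. ?C r \<longrightarrow> \<not> ?P r)"
    proof (cases "n div 2 ^ j mod 2 = 0")
      case True
      have "?P r" if "?C r" for r
        using that[symmetric] less[of r] True unfolding mod by simp
      then show ?thesis by blast
    next
      case False
      have "\<not> ?P r" if "?C r" for r
        using that[symmetric] less[of r] False unfolding mod by auto
      then show ?thesis by blast
    qed
    then have "filter ?C (filter ?P zs @ filter (\<lambda>r. \<not> ?P r) zs) = filter ?C zs" for zs
      by (rule refine)
    ultimately show "filter ?C xs =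
        filter ?C (filter ?P (ys j xs) @ filter (\<lambda>r. \<not> ?P r) (ys j xs))"
      by simp
  qed
  then show ?thesis
    by (simp add: ys_def)
qed

text \<open>The seven passes: the dummy write, one read and two writes to split, two reads and one
  write to merge.\<close>

lemma wp_bit_pass:
  assumes "length (mem s) = 9" "mem s ! 4 = Num w" "0 < w" "2 \<le> M"
    and streams: "distinct [a, b, c]" "{a, b, c} \<subseteq> {1..k}"
    and key: "key = 2 \<and> f = second \<or> key = 3 \<and> f = third"
    and xs: "tape s a = map (entry g) xs" "\<forall>r\<in>set xs. f r \<le> M"
    and Q: "\<And>s'. frame (mem s) (mem s') \<Longrightarrow> passes s' = passes s + 7 \<Longrightarrow>
      tape s' a = map (entry g) (filter (\<lambda>r. f r div w mod 2 = 0) xs @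
        filter (\<lambda>r. f r div w mod 2 \<noteq> 0) xs) \<Longrightarrow> Q s'"
  shows "wp k M (bit_pass a b c key) Q s"
proof -
  let ?P = "\<lambda>r. f r div w mod 2 = 0"
  have abc: "a \<noteq> b" "b \<noteq> a" "a \<noteq> c" "c \<noteq> a" "b \<noteq> c" "c \<noteq> b" "Suc 0 \<le> a" "Suc 0 \<le> b"
    "Suc 0 \<le> c" "a \<le> k" "b \<le> k" "c \<le> k"
    using streams by auto
  have copy: "wp k M (copy_entries b a) (wp k M (copy_entries c a) Q) t"
    if t: "frame (mem s) (mem t)" "passes t = passes s + 7" "head t a = Writing" "tape t a = []"
      "head t b = Reading 0" "tape t b = map (entry g) (filter ?P xs)"
      "head t c = Reading 0" "tape t c = map (entry g) (filter (\<lambda>r. \<not> ?P r) xs)" for t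
  proof (rule wp_copy_entries[where g = g and xs = "filter ?P xs"], goal_cases)
    case (5 u)
    show ?case
    proof (rule wp_copy_entries[where g = g and xs = "filter (\<lambda>r. \<not> ?P r) xs"], goal_cases)
      case (5 v)
      with t \<open>frame (mem t) (mem u)\<close> \<open>passes u = passes t\<close> \<open>tape u = _\<close> show ?case
        by (intro Q) (auto intro: frame_trans)
    qed (use 5 t abc in \<open>simp_all add: frame_def\<close>)
  qed (use t abc in \<open>simp_all add: frame_def\<close>)
  have split: "wp k M (each a (Seq (Read a [1, 2, 3])
      (Cond (Equal (Arith Mod (Arith Div (reg key) (reg 4)) (Const 2)) (Const 0))
        (Write b [reg 1, reg 2, reg 3]) (Write c [reg 1, reg 2, reg 3])))) Q' t"
    if t: "frame (mem s) (mem t)" "passes t = passes s + 4" "head t b = Writing" "tape t b = []"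
      "head t c = Writing" "tape t c = []" "head t a = Reading 0" "tape t a = map (entry g) xs"
      and Q': "\<And>t'. frame (mem s) (mem t') \<Longrightarrow> passes t' = passes s + 4 \<Longrightarrow>
        tape t' b = map (entry g) (filter ?P xs) \<Longrightarrow>
        tape t' c = map (entry g) (filter (\<lambda>r. \<not> ?P r) xs) \<Longrightarrow> Q' t'" for Q' t
  proof (rule wp_each[where f = "entry g" and xs = xs and I = "\<lambda>ys t'.
      frame (mem s) (mem t') \<and> passes t' = passes s + 4 \<and> head t' b = Writing \<and>
      head t' c = Writing \<and> unread (head t' a) (tape t' a) (map (entry g) ys) \<and>
      (\<forall>r\<in>set ys. f r \<le> M) \<and>
      tape t' b @ map (entry g) (filter ?P ys) = map (entry g) (filter ?P xs) \<and>
      tape t' c @ map (entry g) (filter (\<lambda>r. \<not> ?P r) ys) =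
        map (entry g) (filter (\<lambda>r. \<not> ?P r) xs)"], goal_cases)
    case (3 y ys t')
    obtain x u d where y: "y = (x, u, d)" by (cases y)
    note inv = 3
    have len: "length (mem t') = 9" "mem t' ! 4 = Num w"
      using inv assms(2) by (simp_all add: frame_def)
    \<comment> \<open>Intermediate results must stay within [0, \<open>M\<close>] for the test to be
      defined.\<close>
    have fy: "f y \<le> M"
      using 3 by simp
    then have "f y div w \<le> M"
      using div_le_dividend[of "f y" w] by linarith
    moreover have "f y div w mod 2 \<le> M"
      using \<open>2 \<le> M\<close> by (simp add: mod_le_divisor)
    ultimately have *: "f y div w \<le> M" "f y div w mod 2 \<le> M" .
    show ?case
      unfolding wp_Seq
    proof (rule wp_Read[where v = "entry g y" and vs = "map (entry g) ys"], goal_cases)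
      case (3 h)
      have mem: "eval M ((mem t')[Suc 0 := Letter (g x), 2 := Num u, 3 := Num d])
          (Arith Mod (Arith Div (reg key) (reg 4)) (Const 2)) = Some (Num (f y div w mod 2))"
        using key len * \<open>0 < w\<close> \<open>2 \<le> M\<close> by (auto simp: y)
      show ?case
        using 3 inv abc len mem by (cases "?P y") (auto simp: y store_in_range frame_read)
    qed (use 3 y in simp_all)
  qed (use t xs Q' in simp_all)
  show ?thesis
    unfolding bit_pass_def
  proof (simp add: abc abc(7-9)[folded One_nat_def] del: One_nat_def, rule split, goal_cases)
    case (9 t)
    then show ?case
      using abc by (simp del: One_nat_def) (rule copy; simp)
  qed (use abc assms(1) xs(1) in \<open>simp_all add: frame_refl\<close>)
qed

lemma floorlog_div2: "0 < n \<Longrightarrow> floorlog 2 n = Suc (floorlog 2 (n div 2))"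
  by (subst compute_floorlog) simp

text \<open>After \<open>j\<close> rounds the list is sorted by its \<open>j\<close> low bits.
  Passes done plus seven per remaining digit of \<open>M\<close> is constant, as halving removes one
  digit.\<close>

lemma wp_radix_sort:
  assumes "length (mem s) = 9" "mem s ! 0 = Num M" "2 \<le> M"
    and streams: "distinct [a, b, c]" "{a, b, c} \<subseteq> {1..k}"
    and key: "key = 2 \<and> f = second \<or> key = 3 \<and> f = third"
    and xs: "tape s a = map (entry g) xs" "\<forall>r\<in>set xs. f r \<le> M"
    and Q: "\<And>s'. length (mem s') = 9 \<Longrightarrow> mem s' ! 0 = Num M \<Longrightarrow>
      passes s' = passes s + 7 * floorlog 2 M \<Longrightarrow>
      tape s' a = map (entry g) (sort_key f xs) \<Longrightarrow> Q s'"
  shows "wp k M (radix_sort a b c key) Q s"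
proof -
  let ?ys = "\<lambda>j. sort_key (\<lambda>r. f r mod 2 ^ j) xs"
  let ?W = "While (Less (Const 0) (reg 5)) (Seq (bit_pass a b c key)
      (Seq (assign 5 (Arith Div (reg 5) (Const 2)))
        (Cond (Less (Const 0) (reg 5)) (assign 4 (Arith Mul (reg 4) (Const 2))) Skip)))"
  have loop: "wp k M ?W Q t"
    if "length (mem t) = 9" "mem t ! 0 = Num M" "mem t ! 5 = Num (M div 2 ^ j)"
      "0 < M div 2 ^ j \<longrightarrow> mem t ! 4 = Num (2 ^ j)" "tape t a = map (entry g) (?ys j)"
      "passes t + 7 * floorlog 2 (M div 2 ^ j) = passes s + 7 * floorlog 2 M" for j t
    using that
  proof (induction "M div 2 ^ j" arbitrary: j t rule: less_induct)
    case less
    show ?case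
    proof (cases "M div 2 ^ j = 0")
      case True
      have "M < 2 ^ j"
        using True by (simp add: div_eq_0_iff)
      \<comment> \<open>All keys are at most \<open>M\<close> and hence below \<open>2 ^ j\<close>,
        so the modulus changes nothing.\<close>
      then have "?ys j = sort_key f xs"
        using xs(2) by (intro sort_key_cong) auto
      with less.prems True show ?thesis
        by (intro wp_While_False Q) (auto simp: floorlog_def)
    next
      case False
      let ?n = "M div 2 ^ j"
      have half: "M div 2 ^ Suc j = ?n div 2"
        by (simp add: div_mult2_eq power_Suc2 del: power_Suc)
      have pow: "2 ^ Suc j \<le> M" if "0 < ?n div 2"
        using that unfolding half[symmetric] by (simp add: div_greater_zero_iff)
      have n: "?n \<le> M" "?n div 2 \<le> M"
        by (auto intro: order_trans[OF div_le_dividend])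
      show ?thesis
      proof (rule wp_While_True)
        show "eval_test M t (Less (Const 0) (reg 5)) = Some True"
          using less.prems False n by simp
        show "wp k M (Seq (bit_pass a b c key)
            (Seq (assign 5 (Arith Div (reg 5) (Const 2)))
              (Cond (Less (Const 0) (reg 5)) (assign 4 (Arith Mul (reg 4) (Const 2))) Skip)))
            (wp k M ?W Q) (tick t)"
          unfolding wp_Seq
        proof (rule wp_bit_pass[OF _ _ _ assms(3) streams key,
              where g = g and w = "2 ^ j" and xs = "?ys j"], goal_cases)
          case (6 u)
          have IH: "wp k M ?W Q v"
            if "length (mem v) = 9" "mem v ! 0 = Num M" "mem v ! 5 = Num (?n div 2)"
              "0 < ?n div 2 \<longrightarrow> mem v ! 4 = Num (2 ^ Suc j)" "tape v = tape u"
              "passes v = passes u" for v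
          proof (rule less.hyps[of "Suc j"])
            show "M div 2 ^ Suc j < M div 2 ^ j"
              unfolding half using False by simp
            show "tape v a = map (entry g) (?ys (Suc j))"
              using 6(3) that(5) unfolding radix_step by simp
            show "passes v + 7 * floorlog 2 (M div 2 ^ Suc j) = passes s + 7 * floorlog 2 M"
              unfolding half using 6(2) that less.prems(6) False floorlog_div2[of ?n] by simp
          qed (use that half in simp_all)
          have u: "length (mem u) = 9" "mem u ! 0 = Num M" "mem u ! 4 = Num (2 ^ j)"
            "mem u ! 5 = Num ?n"
            using 6(1) frame_nth[OF 6(1)] less.prems False by (simp_all add: frame_def)
          show ?case
            using u n pow \<open>2 \<le> M\<close>
            by (auto simp: store_in_range mult.commute simp del: div_eq_0_iff
                div_greater_zero_iff intro!: IH)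
        qed (use less.prems False xs(2) in auto)
      qed
    qed
  qed
  \<comment> \<open>Modulo 1 all keys coincide.\<close>
  have "?ys 0 = xs"
    by (rule sort_key_id_if_sorted) (simp add: sorted_map sorted_wrt_iff_nth_less)
  with assms(1-3) xs(1) show ?thesis
    unfolding radix_sort_def
    by (auto simp: store_in_range intro!: loop[of _ 0])
qed

section \<open>The linear scans\<close>

text \<open>Subtraction below 0 is undefined, so the depth counter of the program needs this
  condition.\<close>

fun balanced :: "nat \<Rightarrow> 'a tag list \<Rightarrow> bool" where
  "balanced d [] = True"
| "balanced d (Open a # w) = balanced (Suc d) w"
| "balanced d (Close a # w) = (0 < d \<and> balanced (d - 1) w)"

lemma balanced_XML: "balanced d (XML t @ w) = balanced d w"
proof (induction t arbitrary: d w)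
  case (UNode a ts)
  have "balanced d (concat (map XML us) @ w) = balanced d w" if "set us \<subseteq> set ts" for us d w
    using that by (induction us) (simp_all add: UNode.IH)
  then show ?case by simp
qed

lemma wp_write_entries:
  fixes w :: "'a tag list"
  assumes "M = length w" "2 \<le> M" "balanced 0 w" "3 \<le> k"
    and Q: "\<And>s'. length (mem s') = 9 \<Longrightarrow> mem s' ! 0 = Num M \<Longrightarrow> passes s' = 2 \<Longrightarrow>
      tape s' 1 = map (entry Inr) (entries M 0 0 L w) \<Longrightarrow> Q s'"
  shows "wp k M write_entries Q (init (map Inl w))"
proof -
  let ?side = "\<lambda>sd. if sd = L then 0 else 1"
  \<comment> \<open>\<open>d \<le> p\<close> together with \<open>p + length ys = M\<close> keeps
    the incremented depth within \<open>M\<close>.\<close>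
  define I where "I ys s' \<longleftrightarrow> (\<exists>p d sd. length (mem s') = 9 \<and> mem s' ! 0 = Num M \<and> passes s' = 2 \<and>
    mem s' ! 6 = Num p \<and> mem s' ! 7 = Num d \<and> mem s' ! 8 = Num (?side sd) \<and>
    p + length ys = M \<and> d \<le> p \<and> balanced d ys \<and> head s' 1 = Writing \<and>
    unread (head s' 0) (tape s' 0) (map (\<lambda>x. [Letter (Inl x)]) ys) \<and>
    tape s' 1 @ map (entry Inr) (entries M p d sd ys) = map (entry Inr) (entries M 0 0 L w))"
    for ys and s' :: "'a letter state"
  have mem: "store 8 (Num 0) [Num M] = Num M # replicate 8 (Num 0)"
    by (simp add: store_def replicate_append_same[symmetric] numeral_eq_Suc)
  have k: "1 \<le> k"
    using assms(4) by simp
  show ?thesis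
    unfolding write_entries_def
  proof (simp del: One_nat_def add: init_def assms(1)[symmetric] mem k,
      rule wp_each[where I = I and xs = w and f = "\<lambda>x. [Letter (Inl x)]"], goal_cases)
    case 1
    show ?case
      using assms(1-3) unfolding I_def
      by (intro exI[of _ 0] exI[of _ L]) (simp add: on_stream_def numeral_eq_Suc)
  next
    case (2 ys s')
    then show ?case by (auto simp: I_def)
  next
    case (3 y ys s')
    then obtain p d sd where inv: "length (mem s') = 9" "mem s' ! 0 = Num M" "passes s' = 2"
      "mem s' ! 6 = Num p" "mem s' ! 7 = Num d" "mem s' ! 8 = Num (?side sd)"
      "p + length (y # ys) = M" "d \<le> p" "balanced d (y # ys)" "head s' 1 = Writing"
      "unread (head s' 0) (tape s' 0) (map (\<lambda>x. [Letter (Inl x)]) (y # ys))"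
      "tape s' 1 @ map (entry Inr) (entries M p d sd (y # ys)) =
        map (entry Inr) (entries M 0 0 L w)"
      unfolding I_def by blast
    show ?case
      unfolding wp_Seq
    proof (rule wp_Read[where v = "[Letter (Inl y)]" and vs = "map (\<lambda>x. [Letter (Inl x)]) ys"],
        goal_cases)
      case (3 h)
      show ?case
      proof (cases y)
        case (Open a)
        have I_next: "I ys u" if "length (mem u) = 9" "mem u ! 0 = Num M" "passes u = 2"
          "mem u ! 6 = Num (Suc p)" "mem u ! 7 = Num (Suc d)" "mem u ! 8 = Num 0"
          "head u = (head s')(0 := h)"
          "tape u = (tape s')(1 := tape s' 1 @ [entry Inr (Open (a, sd), M - p, d)])" for u
          using that inv 3 Open unfolding I_def
          by (intro exI[of _ "Suc p"] exI[of _ "Suc d"] exI[of _ L]) simp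
        show ?thesis
          using inv 3 Open \<open>2 \<le> M\<close>
          by (cases sd) (auto simp: store_in_range simp del: One_nat_def intro!: I_next)
      next
        case (Close a)
        have I_next: "I ys u" if "length (mem u) = 9" "mem u ! 0 = Num M" "passes u = 2"
          "mem u ! 6 = Num (Suc p)" "mem u ! 7 = Num (d - 1)" "mem u ! 8 = Num 1"
          "head u = (head s')(0 := h)"
          "tape u = (tape s')(1 := tape s' 1 @ [entry Inr (Close (a, R), M - p, d)])" for u
          using that inv 3 Close unfolding I_def
          by (intro exI[of _ "Suc p"] exI[of _ "d - 1"] exI[of _ R]) simp
        show ?thesis
          using inv 3 Close \<open>2 \<le> M\<close>
          by (auto simp: store_in_range simp del: One_nat_def intro!: I_next)
      qed
    qed (use inv in simp_all)
  next
    case (4 s')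
    then show ?case
      by (intro Q) (auto simp: I_def)
  qed
qed

text \<open>The radix sort inspects only as many bits as \<open>M\<close> has, hence its keys must
  not exceed \<open>M\<close>.\<close>

lemma keyed_tags_bound:
  "r \<in> set (keyed_tags M P xs) \<Longrightarrow> P \<le> M \<Longrightarrow> second r \<le> M"
  by (induction M P xs rule: keyed_tags.induct) auto

lemma entries_bound:
  "r \<in> set (entries M p d s w) \<Longrightarrow> d \<le> p \<Longrightarrow> p + length w \<le> M \<Longrightarrow>
    second r \<le> M \<and> third r \<le> M"
  by (induction M p d s w rule: entries.induct) auto

lemma wp_write_keyed_tags:
  fixes s :: "'a letter state"
  assumes "length (mem s) = 9" "mem s ! 0 = Num M" "2 \<le> k"
    and xs: "tape s 1 = map (entry Inr) xs" "\<forall>r\<in>set xs. second r \<le> M"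
    and Q: "\<And>s'. length (mem s') = 9 \<Longrightarrow> mem s' ! 0 = Num M \<Longrightarrow> passes s' = passes s + 2 \<Longrightarrow>
      tape s' 2 = map (entry Inr) (keyed_tags M M xs) \<Longrightarrow> Q s'"
  shows "wp k M write_keyed_tags Q s"
proof -
  define I where "I ys s' \<longleftrightarrow> (\<exists>P. length (mem s') = 9 \<and> mem s' ! 0 = Num M \<and>
    passes s' = passes s + 2 \<and> mem s' ! 6 = Num P \<and> P \<le> M \<and> (\<forall>r\<in>set ys. second r \<le> M) \<and>
    head s' 2 = Writing \<and> unread (head s' 1) (tape s' 1) (map (entry Inr) ys) \<and>
    tape s' 2 @ map (entry Inr) (keyed_tags M P ys) = map (entry Inr) (keyed_tags M M xs))"
    for ys and s' :: "'a letter state"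
  show ?thesis
    unfolding write_keyed_tags_def
  proof (simp del: One_nat_def add: store_in_range assms(1-3) order_trans[OF _ assms(3)],
      rule wp_each[where I = I and xs = xs and f = "entry Inr"], goal_cases)
    case 1
    show ?case
      unfolding I_def using assms(1,2) xs by (intro exI[of _ M]) simp
  next
    case (2 ys s')
    then show ?case by (auto simp: I_def)
  next
    case (3 y ys s')
    then obtain P where inv: "length (mem s') = 9" "mem s' ! 0 = Num M"
      "passes s' = passes s + 2" "mem s' ! 6 = Num P" "P \<le> M" "\<forall>r\<in>set (y # ys). second r \<le> M"
      "head s' 2 = Writing" "unread (head s' 1) (tape s' 1) (map (entry Inr) (y # ys))"
      "tape s' 2 @ map (entry Inr) (keyed_tags M P (y # ys)) =
        map (entry Inr) (keyed_tags M M xs)"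
      unfolding I_def by blast
    obtain x u d where y: "y = (x, u, d)" by (cases y)
    show ?case
      unfolding wp_Seq
    proof (rule wp_Read[where v = "entry Inr y" and vs = "map (entry Inr) ys"], goal_cases)
      case (3 h)
      show ?case
      proof (cases x)
        case (Open a)
        have I_next: "I ys t" if "length (mem t) = 9" "mem t ! 0 = Num M"
          "passes t = passes s + 2" "mem t ! 6 = Num P" "head t = (head s')(1 := h)"
          "tape t = (tape s')(2 := tape s' 2 @ map (entry Inr) [(Open a, M - u, 0), (Close a, P, 0)])"
          for t
          using that inv 3 y Open unfolding I_def by (intro exI[of _ P]) simp
        show ?thesis
          using inv 3 y Open
          by (auto simp: store_in_range simp del: One_nat_def intro!: I_next)
      next
        case (Close a)
        have I_next: "I ys t" if "length (mem t) = 9" "mem t ! 0 = Num M"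
          "passes t = passes s + 2" "mem t ! 6 = Num (M - u)" "head t = (head s')(1 := h)"
          "tape t = tape s'" for t
          using that inv 3 y Close unfolding I_def by (intro exI[of _ "M - u"]) simp
        show ?thesis
          using inv 3 y Close
          by (auto simp: store_in_range simp del: One_nat_def intro!: I_next)
      qed
    qed (use inv y in simp_all)
  next
    case (4 s')
    then show ?case
      by (intro Q) (auto simp: I_def)
  qed
qed

lemma wp_write_tags:
  fixes s :: "'l state"
  assumes "length (mem s) = 9" "3 \<le> k" "tape s 2 = map (entry g) xs"
    and Q: "\<And>s'. passes s' = passes s + 2 \<Longrightarrow>
      tape s' 3 = on_stream (map (\<lambda>r. g (fst r)) xs) \<Longrightarrow> Q s'"
  shows "wp k M write_tags Q s"
proof -
  define I where "I ys s' \<longleftrightarrow> length (mem s') = 9 \<and> passes s' = passes s + 2 \<and>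
    head s' 3 = Writing \<and> unread (head s' 2) (tape s' 2) (map (entry g) ys) \<and>
    tape s' 3 @ on_stream (map (\<lambda>r. g (fst r)) ys) = on_stream (map (\<lambda>r. g (fst r)) xs)"
    for ys and s' :: "'l state"
  show ?thesis
    unfolding write_tags_def
  proof (simp del: One_nat_def add: order_trans[OF _ assms(2)],
      rule wp_each[where I = I and xs = xs and f = "entry g"], goal_cases)
    case 1
    show ?case
      using assms(1,3) by (simp add: I_def)
  next
    case (3 y ys s')
    obtain x u d where y: "y = (x, u, d)" by (cases y)
    from 3 show ?case
      unfolding wp_Seq
      by (intro wp_Read[where v = "entry g y" and vs = "map (entry g) ys"])
        (simp_all add: I_def y store_in_range on_stream_def)
  next
    case (4 s')
    then show ?case
      by (intro Q) (auto simp: I_def on_stream_def)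
  qed (simp add: I_def)
qed

section \<open>Assembly and asymptotic bounds\<close>

text \<open>Three sorts take seven passes per digit each, three scans two passes each.\<close>

lemma wp_fcns_program:
  fixes t :: "'a utree"
  assumes "M = length (XML t)"
  shows "wp 3 M fcns_program (\<lambda>s. tape s 3 = on_stream (map Inr (XML_bin (FCNS t))) \<and>
    passes s = 21 * floorlog 2 M + 6) (init (map Inl (XML t)))"
proof -
  let ?A = "entries M 0 0 L (XML t)"
  let ?K = "keyed_tags M M (sort_key third (sort_key second ?A))"
  have M: "2 \<le> M"
    unfolding assms by (cases t) simp
  have balanced: "balanced 0 (XML t)"
    using balanced_XML[of 0 t "[]"] by simp
  have A: "second r \<le> M \<and> third r \<le> M" if "r \<in> set ?A" for r
    using entries_bound[OF that] by (simp add: assms)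
  have K: "second r \<le> M" if "r \<in> set ?K" for r
    using keyed_tags_bound[OF that] by simp
  show ?thesis
    unfolding fcns_program_def wp_Seq
  proof (rule wp_write_entries[OF assms M balanced], goal_cases)
    case (2 s1)
    show ?case
    proof (rule wp_radix_sort[where f = second and g = Inr and xs = ?A], goal_cases)
      case (9 s2)
      show ?case
      proof (rule wp_radix_sort[where f = third and g = Inr and xs = "sort_key second ?A"],
          goal_cases)
        case (9 s3)
        show ?case
        proof (rule wp_write_keyed_tags[where xs = "sort_key third (sort_key second ?A)"],
            goal_cases)
          case (6 s4)
          show ?case
          proof (rule wp_radix_sort[where f = second and g = Inr and xs = ?K], goal_cases)
            case (9 s5)
            show ?case
            proof (rule wp_write_tags[where g = Inr and xs = "sort_key second ?K"], goal_cases)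
              case (4 s6)
              have "map fst (sort_key second ?K) = XML_bin (FCNS t)"
                by (rule FCNS_by_sorting[OF assms])
              then have "tape s6 3 = on_stream (map Inr (XML_bin (FCNS t)))"
                using 4 by (metis (no_types, lifting) comp_apply list.map_comp map_cong)
              with 2 \<open>passes s2 = _\<close> \<open>passes s3 = _\<close> \<open>passes s4 = _\<close> \<open>passes s5 = _\<close> \<open>passes s6 = _\<close>
              show ?case by simp
            qed (use 9 in simp_all)
          qed (use 6 M K in simp_all)
        qed (use 9 A in simp_all)
      qed (use 9 A M in simp_all)
    qed (use 2 A M in simp_all)
  qed simp
qed

lemma floorlog_double_le:
  assumes "1 \<le> N"
  shows "real (floorlog 2 (2 * N)) \<le> log 2 (real N) + 2"
proof -
  have "floorlog 2 (2 * N) = nat \<lfloor>log 2 (real (2 * N))\<rfloor> + 1"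
    using assms by (simp add: floorlog_def)
  moreover have "log 2 (real (2 * N)) = 1 + log 2 (real N)"
    using assms by (simp add: log_mult)
  moreover have "0 \<le> log 2 (real N)"
    using assms by simp
  ultimately show ?thesis
    by linarith
qed

lemma floorlog_double_bigo:
  "(\<lambda>N. real (a * floorlog 2 (2 * N) + b)) \<in> O(\<lambda>N. log 2 (real N))"
proof (rule bigoI)
  show "\<forall>\<^sub>F N in sequentially.
      norm (real (a * floorlog 2 (2 * N) + b)) \<le> real (3 * a + b) * norm (log 2 (real N))"
    using eventually_ge_at_top[of 2]
  proof eventually_elim
    case (elim N)
    have l: "1 \<le> log 2 (real N)"
      using elim by simp
    \<comment> \<open>For \<open>N \<ge> 2\<close> the logarithm is at least 1 and absorbs the
      additive 2.\<close>
    have "real (floorlog 2 (2 * N)) \<le> 3 * log 2 (real N)"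
      using floorlog_double_le[of N] elim l by linarith
    then have "real a * real (floorlog 2 (2 * N)) \<le> real a * (3 * log 2 (real N))"
      by (rule mult_left_mono) simp
    moreover have "real b \<le> real b * log 2 (real N)"
      using l by (simp add: mult_le_cancel_left1)
    ultimately show ?case
      using l by (simp add: algebra_simps)
  qed
qed

theorem theorem3:
  "\<exists>(alg :: ('a :: finite) letter com) p sp pt :: nat \<Rightarrow> nat.
     (\<lambda>N. real (p N)) \<in> O(\<lambda>N. log 2 (real N)) \<and>
     (\<lambda>N. real (sp N)) \<in> O(\<lambda>N. log 2 (real N)) \<and>
     (\<lambda>N. real (pt N)) \<in> O(\<lambda>N. 1) \<and>
     (\<forall>t :: 'a utree.
        computes 3 (p (nodes t)) (sp (nodes t)) (pt (nodes t)) alg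
          (map Inl (XML t)) 3 (map Inr (XML_bin (FCNS t))))"
proof -
  let ?alg = "fcns_program :: 'a letter com"
  let ?p = "\<lambda>N. 21 * floorlog 2 (2 * N) + 6"
  \<comment> \<open>The factor 9 is the number of memory cells.\<close>
  let ?sp = "\<lambda>N. 9 * floorlog 2 (2 * N) + 0"
  let ?pt = "\<lambda>N :: nat. reset_time ?alg + run_time ?alg"
  have "computes 3 (?p (nodes t)) (?sp (nodes t)) (?pt (nodes t)) ?alg
      (map Inl (XML t)) 3 (map Inr (XML_bin (FCNS t)))" for t :: "'a utree"
  proof -
    let ?M = "2 * nodes t"
    let ?s = "init (map Inl (XML t)) :: 'a letter state"
    obtain s where s: "exec 3 ?M ?alg ?s s"
      "tape s 3 = on_stream (map Inr (XML_bin (FCNS t)))" "passes s = ?p (nodes t)"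
      using wp_fcns_program[OF refl, of t] by (auto simp: wp_def length_XML)
    have M: "1 \<le> ?M"
      by (cases t) simp
    have "bounded_state ?M 9 ?s"
      using M by (auto simp: bounded_state_def init_def on_stream_def length_XML mem_size_def
          floorlog_def)
    then have "peak_space s \<le> ?sp (nodes t)"
      using exec_bounded_state[OF s(1) stores_below_fcns_program M] by (simp add: bounded_state_def)
    moreover have "proc_time s \<le> ?pt (nodes t)"
      using exec_time[OF s(1) loops_do_io_fcns_program] by (simp add: init_def)
    ultimately show ?thesis
      unfolding computes_def using s by (auto simp: length_XML)
  qed
  then show ?thesis
    using floorlog_double_bigo[of 21 6] floorlog_double_bigo[of 9 0]
    by (intro exI[of _ ?alg] exI[of _ ?p] exI[of _ ?sp] exI[of _ ?pt]) auto
qed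

end
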